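(* Let $\theta_0\in\mathbb{R}_+$ be the true parameter. Assume that the prior density $\varrho\in\mathcal{Q}$ is positive and continuous in a neighborhood of $\theta_0$, and that $\widehat\beta_N$ is well defined with respect to a loss function $\ell\in\mathbf{W}'$, for every $N\in\mathbb{N}$. Moreover, assume that there exist $\{a_N\}_{N\in\mathbb{N}}\subset\mathbb{R}_+$, a non-negative Borel-measurable function $f$ on $\mathbb{R}$ satisfying (C1) there exists $\alpha\in(0,1)$ such that $\int_{\mathbb{R}}f(x)e^{-\alpha x^2/2}\,dx<\infty$, and (C2) for any $\delta>0$, $\lim_{N\to\infty}\int_{\{|\lambda|>\sqrt{I_N}\delta\}}f(\lambda)\,\varrho\big(\widehat\theta_N+\frac{\lambda}{\sqrt{I_N}}\big)e^{-\lambda^2/2}\,d\lambda=0$, $\mathbb{P}$-a.s., and another loss function $\widetilde\ell\in\mathbf{W}'$, such that (i) $a_N\,\ell\big(\lambda/\sqrt{I_N}\big)\le f(\lambda)$ for any $\lambda\in\mathbb{R}$ and $N\in\mathbb{N}$; (ii) $\lim_{N\to\infty}\sup_{\lambda\in B}\big|a_N\,\ell\big(\lambda/\sqrt{I_N}\big)-\widetilde\ell(\lambda)\big|=0$ for any compact set $B\subset\mathbb{R}$; (iii) $r\mapsto\int_{\mathbb{R}}\widetilde\ell(\lambda+r)e^{-\lambda^2/2}\,d\lambda$ has a strict minimum at $r=0$. Then (a) $\lim_{N\to\infty}\sqrt{I_N}\big(\widehat\beta_N-\widehat\theta_N\big)=0$, $\mathbb{P}$-a.s.; (b) $\lim_{N\to\infty}a_N\int_{\mathbb{R}_+}\ell\big(\theta-\widehat\beta_N\big)\,p(\theta\,|\,U_N)\,d\theta=\int_{\mathbb{R}}\widetilde\ell(\lambda)\frac{e^{-\lambda^2/2}}{\sqrt{2\pi}}\,d\lambda$,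 $\mathbb{P}$-a.s. In particular, $\widehat\beta_N\to\theta_0$ $\mathbb{P}$-a.s. and $\sqrt{I_N}(\widehat\beta_N-\theta_0)$ converges in distribution to $\mathcal{N}(0,1)$ as $N\to\infty$.
   Context: $\mathbb{R}_+:=(0,\infty)$. $(\Omega,\mathscr{F},\{\mathscr{F}_t\},\mathbb{P})$ is a stochastic basis satisfying the usual assumptions, with independent standard Brownian motions $\{w_k\}_{k\in\mathbb{N}}$. $\{\mu_k\}\subset(0,\infty)$ with $\mu_k\to\infty$ (the eigenvalues of a positive definite self-adjoint operator $A$ on a separable Hilbert space), $\{q_k\}\subset(0,\infty)$, $\sigma>0$ and $T>0$ are fixed and known. For $\theta\in\mathbb{R}_+$, $u_k^\theta$ is the $k$-th Fourier mode of the solution of $du+\theta Au\,dt=\sigma\sum_ku_kh_kq_k\,dw_k$ ($h_k$ the eigenvectors of $A$), i.e. $du_k^\theta=-\theta\mu_ku_k^\theta\,dt+\sigma q_ku_k^\theta\,dw_k$, so $u_k^\theta(t)=u_k(0)\exp\big(-(\theta\mu_k+\tfrac12\sigma^2q_k^2)t+\sigma q_kw_k(t)\big)$, $t\in[0,T]$, with $\mathscr{F}_0$-measurable $u_k(0)\ne0$ not depending on $\theta$. Standing assumption: the well-posedness condition of the equation holds for at least one parameter value, i.e. there exist $\bar\theta>0$, $N_0\in\mathbb{N}$, $c>0$ with $2\bar\theta-\sigma^2q_k^2/\mu_k\ge c$ for all $k\ge N_0$. The observation is $U_N=(u_1,\dots,u_N)$ on $[0,T]$ with $u_k:=u_k^{\theta_0}$.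 The Fisher information is $I_N:=\frac{T}{\sigma^2}\sum_{k=1}^N\mu_k^2q_k^{-2}$ and $\widehat\theta_N:=-\dfrac{\sum_{k=1}^N\mu_kq_k^{-2}\int_0^T\frac{du_k(t)}{u_k(t)}}{T\sum_{k=1}^N\mu_k^2q_k^{-2}}$. $\mathcal{Q}$ is the set of all non-negative, non-trivial (Borel) functions on $\mathbb{R}_+$; each $\varrho\in\mathcal{Q}$ is extended by $\varrho(\theta)=0$ for $\theta\le0$. The posterior density is $$p(\theta\,|\,U_N)=\frac{e^{-I_N(\theta-\widehat\theta_N)^2/2}\varrho(\theta)}{\int_{\mathbb{R}_+}e^{-I_N(\eta-\widehat\theta_N)^2/2}\varrho(\eta)\,d\eta},\quad\theta\in\mathbb{R}_+,$$ it being understood that the denominator is finite and positive for every $N$, a.s. $\mathbf{W}'$ is the class of non-negative, Borel-measurable, locally bounded functions $\ell$ on $\mathbb{R}$ with $\ell(0)=0$ and $\ell(x_1)\le\ell(x_2)$ whenever $|x_1|\le|x_2|$. The Bayesian estimator with respect to $\ell\in\mathbf{W}'$ is $$\widehat\beta_N:=\operatorname*{arg\,min}_{\beta\in\mathbb{R}_+}\int_{\mathbb{R}_+}\ell(\eta-\beta)\,p(\eta\,|\,U_N)\,d\eta,$$ which is well defined when this minimum is strict and attained. *)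

theory Defs
  imports "HOL-Probability.Probability"
begin

section \<open>Stochastic bases and Brownian motions\<close>

text \<open>
  Only times \<open>t \<ge> 0\<close> matter. The filtration is indexed by all reals in order to use the library
  locale; one given on \<open>[0, \<infinity>)\<close> is extended by \<open>F t = F 0\<close> for \<open>t < 0\<close>.
\<close>

definition stochastic_basis :: "'a measure \<Rightarrow> (real \<Rightarrow> 'a measure) \<Rightarrow> bool" where
  "stochastic_basis M F \<longleftrightarrow>
     prob_space M \<and> complete_measure M \<and>
     filtration (space M) F \<and> (\<forall>t. subalgebra M (F t)) \<and>
     null_sets M \<subseteq> sets (F 0) \<and>
     (\<forall>t\<ge>0. sets (F t) = (\<Inter>s\<in>{t<..}. sets (F s)))"

definition brownian_motion ::
    "'a measure \<Rightarrow> (real \<Rightarrow> 'a measure) \<Rightarrow> (real \<Rightarrow> 'a \<Rightarrow> real) \<Rightarrow> bool" where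
  "brownian_motion M F w \<longleftrightarrow>
     (\<forall>t\<ge>0. w t \<in> borel_measurable (F t)) \<and>
     (AE \<omega> in M. w 0 \<omega> = 0) \<and>
     (AE \<omega> in M. continuous_on {0..} (\<lambda>t. w t \<omega>)) \<and>
     (\<forall>s t. 0 \<le> s \<longrightarrow> s < t \<longrightarrow>
        distributed M lborel (\<lambda>\<omega>. w t \<omega> - w s \<omega>) (normal_density 0 (sqrt (t - s))) \<and>
        prob_space.indep_set M (sets (F s))
          {(\<lambda>\<omega>. w t \<omega> - w s \<omega>) -` B \<inter> space M | B. B \<in> sets borel})"

text \<open>Independence of processes: independence of the path-valued random variables.\<close>

definition indep_processes ::
    "'a measure \<Rightarrow> (nat \<Rightarrow> real \<Rightarrow> 'a \<Rightarrow> real) \<Rightarrow> nat set \<Rightarrow> bool" where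
  "indep_processes M w K \<longleftrightarrow>
     prob_space.indep_vars M (\<lambda>_. PiM {0..} (\<lambda>_. borel)) (\<lambda>k \<omega>. \<lambda>t\<in>{0..}. w k t \<omega>) K"

section \<open>Modes of convergence\<close>

definition conv_in_prob :: "'a measure \<Rightarrow> (nat \<Rightarrow> 'a \<Rightarrow> real) \<Rightarrow> ('a \<Rightarrow> real) \<Rightarrow> bool" where
  "conv_in_prob M X Y \<longleftrightarrow>
     (\<forall>\<epsilon>>0. (\<lambda>n. measure M {\<omega> \<in> space M. \<bar>X n \<omega> - Y \<omega>\<bar> > \<epsilon>}) \<longlonglongrightarrow> 0)"

text \<open>
  The measurability clause only says that the (eventual) \<open>X N\<close> are random variables, without which
  \<^const>\<open>distr\<close> is meaningless.
\<close>

definition conv_in_distribution :: "'a measure \<Rightarrow> (nat \<Rightarrow> 'a \<Rightarrow> real) \<Rightarrow> real measure \<Rightarrow> bool" where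
  "conv_in_distribution M X \<nu> \<longleftrightarrow>
     (\<forall>\<^sub>F N in sequentially. X N \<in> borel_measurable M) \<and>
     weak_conv_m (\<lambda>N. distr M borel (X N)) \<nu>"

section \<open>The stochastic integral of a continuous adapted process\<close>

text \<open>
  Simple predictable integrands on \<open>(0, T]\<close>: on \<open>(\<tau> i, \<tau> (i+1)]\<close>, where
  \<open>0 = \<tau> 0 \<le> \<dots> \<le> \<tau> m = T\<close>, the value is the \<open>F (\<tau> i)\<close>-measurable random variable \<open>\<xi> i\<close>.
\<close>

definition simple_integrand ::
    "(real \<Rightarrow> 'a measure) \<Rightarrow> real \<Rightarrow> nat \<Rightarrow> (nat \<Rightarrow> real) \<Rightarrow> (nat \<Rightarrow> 'a \<Rightarrow> real) \<Rightarrow> bool" where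
  "simple_integrand F T m \<tau> \<xi> \<longleftrightarrow>
     \<tau> 0 = 0 \<and> \<tau> m = T \<and> (\<forall>i<m. \<tau> i \<le> \<tau> (Suc i)) \<and> (\<forall>i<m. \<xi> i \<in> borel_measurable (F (\<tau> i)))"

definition simple_path :: "nat \<Rightarrow> (nat \<Rightarrow> real) \<Rightarrow> (nat \<Rightarrow> 'a \<Rightarrow> real) \<Rightarrow> real \<Rightarrow> 'a \<Rightarrow> real" where
  "simple_path m \<tau> \<xi> t \<omega> = (\<Sum>i<m. \<xi> i \<omega> * indicator {\<tau> i<..\<tau> (Suc i)} t)"

definition simple_integral ::
    "nat \<Rightarrow> (nat \<Rightarrow> real) \<Rightarrow> (nat \<Rightarrow> 'a \<Rightarrow> real) \<Rightarrow> (real \<Rightarrow> 'a \<Rightarrow> real) \<Rightarrow> 'a \<Rightarrow> real" where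
  "simple_integral m \<tau> \<xi> X \<omega> = (\<Sum>i<m. \<xi> i \<omega> * (X (\<tau> (Suc i)) \<omega> - X (\<tau> i) \<omega>))"

text \<open>
  \<open>J\<close> is a version of \<open>\<integral>\<^sub>0\<^sup>T H dX\<close>, for a semimartingale \<open>X\<close> and an adapted process \<open>H\<close> with almost
  surely continuous paths on \<open>[0, T]\<close>: \<open>J\<close> is the limit in probability of the elementary integrals
  for every approximation of \<open>H\<close> by simple integrands, uniformly on \<open>(0, T]\<close> almost surely.
  By passing to subsequences, this is the same as requiring it for all approximations that are
  uniform in probability (ucp). Such approximations exist (left-point sampling of \<open>H\<close>), so \<open>J\<close> is
  determined up to a null set.
\<close>

definition is_stochastic_integral ::
    "'a measure \<Rightarrow> (real \<Rightarrow> 'a measure) \<Rightarrow> real \<Rightarrow> (real \<Rightarrow> 'a \<Rightarrow> real) \<Rightarrow> (real \<Rightarrow> 'a \<Rightarrow> real) \<Rightarrow>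
     ('a \<Rightarrow> real) \<Rightarrow> bool" where
  "is_stochastic_integral M F T H X J \<longleftrightarrow>
     J \<in> borel_measurable M \<and>
     (\<forall>m \<tau> \<xi>.
        (\<forall>n. simple_integrand F T (m n) (\<tau> n) (\<xi> n)) \<longrightarrow>
        (AE \<omega> in M. uniform_limit {0<..T} (\<lambda>n t. simple_path (m n) (\<tau> n) (\<xi> n) t \<omega>)
                        (\<lambda>t. H t \<omega>) sequentially) \<longrightarrow>
        conv_in_prob M (\<lambda>n. simple_integral (m n) (\<tau> n) (\<xi> n) X) J)"

section \<open>The diagonal model and its maximum likelihood estimator\<close>

text \<open>All families of modes are indexed by \<open>k \<ge> 1\<close>; the values at \<open>k = 0\<close> are irrelevant.\<close>

definition fourier_mode ::
    "real \<Rightarrow> (nat \<Rightarrow> real) \<Rightarrow> (nat \<Rightarrow> real) \<Rightarrow> (nat \<Rightarrow> 'a \<Rightarrow> real) \<Rightarrow> (nat \<Rightarrow> real \<Rightarrow> 'a \<Rightarrow> real) \<Rightarrow>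
     real \<Rightarrow> nat \<Rightarrow> real \<Rightarrow> 'a \<Rightarrow> real" where
  "fourier_mode \<sigma> \<mu> q u0 w \<theta> k t \<omega> =
     u0 k \<omega> * exp (- (\<theta> * \<mu> k + \<sigma>\<^sup>2 * (q k)\<^sup>2 / 2) * t + \<sigma> * q k * w k t \<omega>)"

definition fisher_information ::
    "real \<Rightarrow> real \<Rightarrow> (nat \<Rightarrow> real) \<Rightarrow> (nat \<Rightarrow> real) \<Rightarrow> nat \<Rightarrow> real" where
  "fisher_information \<sigma> T \<mu> q N = T / \<sigma>\<^sup>2 * (\<Sum>k=1..N. (\<mu> k)\<^sup>2 / (q k)\<^sup>2)"

text \<open>\<open>J k\<close> stands for \<open>\<integral>\<^sub>0\<^sup>T du\<^sub>k(t) / u\<^sub>k(t)\<close>.\<close>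

definition theta_hat ::
    "real \<Rightarrow> (nat \<Rightarrow> real) \<Rightarrow> (nat \<Rightarrow> real) \<Rightarrow> (nat \<Rightarrow> 'a \<Rightarrow> real) \<Rightarrow> nat \<Rightarrow> 'a \<Rightarrow> real" where
  "theta_hat T \<mu> q J N \<omega> =
     - (\<Sum>k=1..N. \<mu> k / (q k)\<^sup>2 * J k \<omega>) / (T * (\<Sum>k=1..N. (\<mu> k)\<^sup>2 / (q k)\<^sup>2))"

section \<open>Priors, posteriors, loss functions and Bayesian estimators\<close>

definition prior_class :: "(real \<Rightarrow> real) set" where
  "prior_class = {\<rho>. \<rho> \<in> borel_measurable borel \<and> (\<forall>\<theta>. \<rho> \<theta> \<ge> 0) \<and> (\<forall>\<theta>\<le>0. \<rho> \<theta> = 0) \<and>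
                     (\<exists>\<theta>>0. \<rho> \<theta> \<noteq> 0)}"

definition loss_class :: "(real \<Rightarrow> real) set" where
  "loss_class = {l. l \<in> borel_measurable borel \<and> (\<forall>x. l x \<ge> 0) \<and>
                    (\<forall>K. compact K \<longrightarrow> bounded (l ` K)) \<and> l 0 = 0 \<and>
                    (\<forall>x y. \<bar>x\<bar> \<le> \<bar>y\<bar> \<longrightarrow> l x \<le> l y)}"

definition post_weight :: "real \<Rightarrow> real \<Rightarrow> (real \<Rightarrow> real) \<Rightarrow> real \<Rightarrow> real" where
  "post_weight I th \<rho> \<theta> = exp (- (I * (\<theta> - th)\<^sup>2 / 2)) * \<rho> \<theta>"

definition post_density :: "real \<Rightarrow> real \<Rightarrow> (real \<Rightarrow> real) \<Rightarrow> real \<Rightarrow> real" where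
  "post_density I th \<rho> \<theta> =
     post_weight I th \<rho> \<theta> / (LINT \<eta>:{0<..}|lborel. post_weight I th \<rho> \<eta>)"

text \<open>The risk may be infinite for some \<open>\<beta>\<close>, hence an extended nonnegative integral.\<close>

definition posterior_risk :: "(real \<Rightarrow> real) \<Rightarrow> (real \<Rightarrow> real) \<Rightarrow> real \<Rightarrow> ennreal" where
  "posterior_risk l p \<beta> = (\<integral>\<^sup>+\<eta>\<in>{0<..}. ennreal (l (\<eta> - \<beta>) * p \<eta>) \<partial>lborel)"

definition strict_min_at :: "(real \<Rightarrow> ennreal) \<Rightarrow> real set \<Rightarrow> real \<Rightarrow> bool" where
  "strict_min_at R S b \<longleftrightarrow> b \<in> S \<and> (\<forall>b'\<in>S. b' \<noteq> b \<longrightarrow> R b < R b')"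

end

theory Submission
  imports Defs "HOL-Real_Asymp.Real_Asymp"
begin

text \<open>
  Fix a realisation and pass to the local parameter \<open>\<lambda> = \<surd>I\<^sub>N (\<theta> - \<theta>\<^sub>N)\<close>, where \<open>\<theta>\<^sub>N\<close> is the
  maximum likelihood estimator. The posterior becomes proportional to
  \<open>exp (-\<lambda>\<^sup>2/2) \<rho> (\<theta>\<^sub>N + \<lambda>/\<surd>I\<^sub>N)\<close>, and since \<open>\<theta>\<^sub>N \<rightarrow> \<theta>0\<close> and \<open>I\<^sub>N \<rightarrow> \<infinity>\<close> the prior enters
  in the limit only through the constant \<open>\<rho> \<theta>0\<close>: the posterior is asymptotically standard Gaussian.
  With \<open>r\<^sub>N = \<surd>I\<^sub>N (\<beta>\<^sub>N - \<theta>\<^sub>N)\<close>, the scaled risk of \<open>\<beta>\<^sub>N\<close> therefore behaves like the Gaussian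
  mean of \<open>l' (\<lambda> - r\<^sub>N)\<close>, which is smallest at \<open>r = 0\<close> only; hence \<open>r\<^sub>N \<rightarrow> 0\<close>.

  The limit is justified by two one-sided bounds (lemma \<open>rescaled_bayes_limit\<close>). From above, \<open>\<beta>\<^sub>N\<close> is
  not worse than \<open>\<theta>\<^sub>N\<close> itself, whose scaled risk converges by dominated convergence near the true
  parameter and by the tail condition on \<open>f\<close> away from it (\<open>gaussian_tilted_limit\<close>). From below, along
  a subsequence with \<open>r\<^sub>N \<rightarrow> R \<in> [-\<infinity>, \<infinity>]\<close>, Fatou's lemma (\<open>gaussian_tilted_fatou\<close>) bounds the lower limit
  by the Gaussian mean of \<open>l' (\<lambda> - R)\<close>; a loss may jump, but as a monotone function of the modulus it
  jumps on a countable set only. If \<open>\<bar>R\<bar> = \<infinity>\<close>, the same argument gives that no value of \<open>l'\<close> exceeds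
  the Gaussian mean of \<open>l'\<close>, and then shifting \<open>l'\<close> cannot increase its mean, against strict minimality
  at \<open>0\<close>. So every subsequential limit is \<open>0\<close>, and the two bounds coincide.

  The probabilistic input is the exact law of \<open>\<theta>\<^sub>N\<close>. The integral of \<open>1/u\<^sub>k\<close> against \<open>u\<^sub>k\<close> equals
  \<open>-\<theta>0 \<mu>\<^sub>k T + \<sigma> q\<^sub>k (w\<^sub>k T - w\<^sub>k 0)\<close> (\<open>stochastic_log_of_geometric_bm\<close>): its left-point sums are sums of
  independent functions of Brownian increments, and a computation with Gaussian moments replaces
  Ito's formula. Hence \<open>\<surd>I\<^sub>N (\<theta>\<^sub>N - \<theta>0)\<close> is standard normal for every \<open>N \<ge> 1\<close>. Well-posedness makes
  \<open>I\<^sub>N\<close> grow at least linearly, so the fourth moments of \<open>\<theta>\<^sub>N - \<theta>0\<close> are summable, which yields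
  \<open>\<theta>\<^sub>N \<rightarrow> \<theta>0\<close> almost surely.

  Convergence in distribution is Slutsky's lemma (\<open>conv_in_distribution_slutsky\<close>), but it
  presupposes that the minimiser \<open>\<beta>\<^sub>N\<close> is a random variable. This holds because the posterior risk is lower
  semicontinuous and, thanks to the monotonicity of the loss, right-continuous in the estimate, so
  that its infima over intervals are infima over countable sets
  (\<open>borel_measurable_strict_minimiser\<close>).
\<close>

section \<open>Almost everywhere continuity of loss functions\<close>

lemma loss_class_measurable: "l \<in> loss_class \<Longrightarrow> l \<in> borel_measurable borel"
  and loss_class_nonneg: "l \<in> loss_class \<Longrightarrow> 0 \<le> l x"
  and loss_class_mono: "l \<in> loss_class \<Longrightarrow> \<bar>x\<bar> \<le> \<bar>y\<bar> \<Longrightarrow> l x \<le> l y"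
  by (auto simp: loss_class_def)

text \<open>A loss is a monotone function of the modulus, so its discontinuities are countable. The limit
theorems below see losses only under an integral over \<open>x\<close>, where this is as good as continuity.\<close>

lemma loss_class_AE_isCont:
  assumes l: "l \<in> loss_class"
  shows "AE x in lborel. isCont l (x - r)"
proof -
  define g where "g y = l (max y 0)" for y
  have "mono g"
    unfolding g_def mono_def by (auto intro: loss_class_mono[OF l])
  then have D: "countable {a. \<not> isCont g a}"
    by (rule mono_ctble_discont)
  let ?D = "{a. \<not> isCont g a}"
  have l_eq: "l = (\<lambda>x. g \<bar>x\<bar>)"
  proof
    fix x show "l x = g \<bar>x\<bar>"
      unfolding g_def using loss_class_mono[OF l, of x "\<bar>x\<bar>"] loss_class_mono[OF l, of "\<bar>x\<bar>" x] by auto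
  qed
  have "isCont l x" if "isCont g \<bar>x\<bar>" for x
    unfolding l_eq using that by (intro isCont_o2[where g=g and f=abs]) auto
  then have "{x. \<not> isCont l (x - r)} \<subseteq> (\<lambda>d. d + r) ` ?D \<union> (\<lambda>d. r - d) ` ?D"
  proof (intro subsetI)
    fix x assume "\<And>x. isCont g \<bar>x\<bar> \<Longrightarrow> isCont l x" "x \<in> {x. \<not> isCont l (x - r)}"
    then have "\<bar>x - r\<bar> \<in> ?D" by auto
    moreover have "x = \<bar>x - r\<bar> + r \<or> x = r - \<bar>x - r\<bar>" by linarith
    ultimately show "x \<in> (\<lambda>d. d + r) ` ?D \<union> (\<lambda>d. r - d) ` ?D" by blast
  qed
  then have "countable {x. \<not> isCont l (x - r)}"
    using D by (meson countable_Un countable_image countable_subset)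
  then have "{x. \<not> isCont l (x - r)} \<in> null_sets lborel"
    by (rule countable_imp_null_set_lborel)
  then show ?thesis
    by (rule AE_I'[where P="\<lambda>x. isCont l (x - r)"]) auto
qed

section \<open>Gaussian integrals tilted by a local prior\<close>

text \<open>The prior is controlled only near \<open>\<theta>0\<close>. Split it at the ball of radius \<open>2\<delta>\<close>: inside, the constant
\<open>B\<close> times the Gaussian integral of \<open>F\<close> dominates; outside, as soon as \<open>t n\<close> is within \<open>\<delta>\<close> of \<open>\<theta>0\<close>,
the variable satisfies \<open>\<bar>x\<bar> > s n * \<delta>\<close>, so that this part is bounded by the tail integral.\<close>

lemma gaussian_tilted_limit:
  fixes s t :: "nat \<Rightarrow> real" and \<rho> F G :: "real \<Rightarrow> real" and g :: "nat \<Rightarrow> real \<Rightarrow> real"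
  assumes s_pos: "\<And>n. s n > 0" and s_lim: "filterlim s at_top sequentially"
    and t_lim: "t \<longlonglongrightarrow> \<theta>0"
    and rho_meas[measurable]: "\<rho> \<in> borel_measurable borel" and rho_nonneg: "\<And>x. 0 \<le> \<rho> x"
    and rho_cont: "isCont \<rho> \<theta>0"
    and delta: "\<delta> > 0" and B: "\<And>x. x \<in> cball \<theta>0 (2 * \<delta>) \<Longrightarrow> \<rho> x \<le> B"
    and g_meas[measurable]: "\<And>n. g n \<in> borel_measurable borel"
    and F_meas[measurable]: "F \<in> borel_measurable borel"
    and g_nonneg: "\<And>n x. 0 \<le> g n x" and g_le: "\<And>n x. g n x \<le> F x"
    and F_int: "(\<integral>\<^sup>+x. ennreal (F x * exp (- x\<^sup>2 / 2)) \<partial>lborel) < \<infinity>"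
    and g_lim: "\<And>x. (\<lambda>n. g n x) \<longlonglongrightarrow> G x"
    and tail: "(\<lambda>n. \<integral>\<^sup>+x\<in>{x. \<bar>x\<bar> > s n * \<delta>}.
                 ennreal (F x * \<rho> (t n + x / s n) * exp (- x\<^sup>2 / 2)) \<partial>lborel) \<longlonglongrightarrow> 0"
  shows "(\<lambda>n. \<integral>\<^sup>+x. ennreal (g n x * (exp (- x\<^sup>2 / 2) * \<rho> (t n + x / s n))) \<partial>lborel)
           \<longlonglongrightarrow> (\<integral>\<^sup>+x. ennreal (G x * (exp (- x\<^sup>2 / 2) * \<rho> \<theta>0)) \<partial>lborel)"
proof -
  define \<rho>1 where "\<rho>1 y = \<rho> y * indicator (cball \<theta>0 (2 * \<delta>)) y" for y
  have [measurable]: "\<rho>1 \<in> borel_measurable borel"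
    unfolding \<rho>1_def by (intro borel_measurable_times borel_measurable_indicator rho_meas) auto
  have B_nonneg: "0 \<le> B"
    using B[of \<theta>0] rho_nonneg[of \<theta>0] delta by (force intro: order_trans)
  have rho1: "0 \<le> \<rho>1 y" "\<rho>1 y \<le> B" "\<rho>1 y \<le> \<rho> y" for y
    using B[of y] rho_nonneg[of y] B_nonneg by (auto simp: \<rho>1_def indicator_def)
  have F_nonneg: "0 \<le> F x" for x
    using g_nonneg[of 0 x] g_le[of 0 x] by simp
  have arg_lim: "(\<lambda>n. t n + x / s n) \<longlonglongrightarrow> \<theta>0" for x
    using tendsto_add[OF t_lim tendsto_divide_0[OF tendsto_const filterlim_at_top_imp_at_infinity[OF s_lim], of x]]
    by simp
  have rho1_lim: "(\<lambda>n. \<rho>1 (t n + x / s n)) \<longlonglongrightarrow> \<rho> \<theta>0" for x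
  proof (rule Lim_transform_eventually)
    show "(\<lambda>n. \<rho> (t n + x / s n)) \<longlonglongrightarrow> \<rho> \<theta>0"
      by (rule isCont_tendsto_compose[OF rho_cont arg_lim])
    have "\<forall>\<^sub>F n in sequentially. dist (t n + x / s n) \<theta>0 < 2 * \<delta>"
      using arg_lim[of x] delta by (intro tendstoD) auto
    then show "\<forall>\<^sub>F n in sequentially. \<rho> (t n + x / s n) = \<rho>1 (t n + x / s n)"
      by eventually_elim (auto simp: \<rho>1_def dist_commute)
  qed
  have lim1: "(\<lambda>n. \<integral>\<^sup>+x. ennreal (g n x * (exp (- x\<^sup>2 / 2) * \<rho>1 (t n + x / s n))) \<partial>lborel)
           \<longlonglongrightarrow> (\<integral>\<^sup>+x. ennreal (G x * (exp (- x\<^sup>2 / 2) * \<rho> \<theta>0)) \<partial>lborel)"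
  proof (rule nn_integral_dominated_convergence[where w="\<lambda>x. ennreal B * ennreal (F x * exp (- x\<^sup>2 / 2))"])
    have "G \<in> borel_measurable borel"
      by (rule borel_measurable_LIMSEQ_metric[OF g_meas]) (use g_lim in auto)
    then show "(\<lambda>x. ennreal (G x * (exp (- x\<^sup>2 / 2) * \<rho> \<theta>0))) \<in> borel_measurable lborel"
      by measurable
    show "AE x in lborel. ennreal (g n x * (exp (- x\<^sup>2 / 2) * \<rho>1 (t n + x / s n)))
            \<le> ennreal B * ennreal (F x * exp (- x\<^sup>2 / 2))" for n
    proof (intro AE_I2)
      fix x
      have "g n x * (exp (- x\<^sup>2 / 2) * \<rho>1 (t n + x / s n)) \<le> F x * (exp (- x\<^sup>2 / 2) * B)"
        using g_le g_nonneg F_nonneg rho1 B_nonneg by (intro mult_mono) auto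
      then show "ennreal (g n x * (exp (- x\<^sup>2 / 2) * \<rho>1 (t n + x / s n)))
            \<le> ennreal B * ennreal (F x * exp (- x\<^sup>2 / 2))"
        using B_nonneg by (simp add: ennreal_mult'[symmetric] ennreal_leI ac_simps)
    qed
    show "(\<integral>\<^sup>+ x. ennreal B * ennreal (F x * exp (- x\<^sup>2 / 2)) \<partial>lborel) < \<infinity>"
      using F_int by (simp add: nn_integral_cmult ennreal_mult_less_top)
    show "AE x in lborel. (\<lambda>n. ennreal (g n x * (exp (- x\<^sup>2 / 2) * \<rho>1 (t n + x / s n))))
            \<longlonglongrightarrow> ennreal (G x * (exp (- x\<^sup>2 / 2) * \<rho> \<theta>0))"
      by (intro AE_I2 tendsto_ennrealI tendsto_mult tendsto_const g_lim rho1_lim)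
  qed measurable
  show ?thesis
  proof (rule tendsto_sandwich[OF _ _ lim1])
    show "\<forall>\<^sub>F n in sequentially.
        (\<integral>\<^sup>+x. ennreal (g n x * (exp (- x\<^sup>2 / 2) * \<rho>1 (t n + x / s n))) \<partial>lborel)
        \<le> (\<integral>\<^sup>+x. ennreal (g n x * (exp (- x\<^sup>2 / 2) * \<rho> (t n + x / s n))) \<partial>lborel)"
      using rho1 g_nonneg
      by (intro always_eventually allI nn_integral_mono ennreal_leI mult_left_mono) auto
    have "\<forall>\<^sub>F n in sequentially. dist (t n) \<theta>0 < \<delta>"
      using t_lim delta by (intro tendstoD) auto
    then show "\<forall>\<^sub>F n in sequentially.
        (\<integral>\<^sup>+x. ennreal (g n x * (exp (- x\<^sup>2 / 2) * \<rho> (t n + x / s n))) \<partial>lborel)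
        \<le> (\<integral>\<^sup>+x. ennreal (g n x * (exp (- x\<^sup>2 / 2) * \<rho>1 (t n + x / s n))) \<partial>lborel)
         + (\<integral>\<^sup>+x\<in>{x. \<bar>x\<bar> > s n * \<delta>}. ennreal (F x * \<rho> (t n + x / s n) * exp (- x\<^sup>2 / 2)) \<partial>lborel)"
    proof eventually_elim
      case (elim n)
      have "ennreal (g n x * (exp (- x\<^sup>2 / 2) * \<rho> (t n + x / s n)))
          \<le> ennreal (g n x * (exp (- x\<^sup>2 / 2) * \<rho>1 (t n + x / s n)))
          + ennreal (F x * \<rho> (t n + x / s n) * exp (- x\<^sup>2 / 2)) * indicator {x. \<bar>x\<bar> > s n * \<delta>} x" for x
      proof (cases "\<bar>x\<bar> > s n * \<delta>")
        case True
        have "ennreal (g n x * (exp (- x\<^sup>2 / 2) * \<rho> (t n + x / s n)))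
            \<le> ennreal (F x * \<rho> (t n + x / s n) * exp (- x\<^sup>2 / 2))"
          using g_le[of n x] rho_nonneg
          by (auto intro!: ennreal_leI mult_right_mono simp: mult.assoc mult.commute[of "\<rho> _"])
        then show ?thesis
          using True by (auto intro: add_increasing)
      next
        case False
        then have "\<bar>x / s n\<bar> \<le> \<delta>"
          using s_pos[of n] by (simp add: field_simps)
        then have "t n + x / s n \<in> cball \<theta>0 (2 * \<delta>)"
          using elim unfolding mem_cball dist_real_def by linarith
        then show ?thesis
          using False by (simp add: \<rho>1_def)
      qed
      then show ?case
        by (subst nn_integral_add[symmetric]) (auto intro!: nn_integral_mono)
    qed
    show "(\<lambda>n. (\<integral>\<^sup>+x. ennreal (g n x * (exp (- x\<^sup>2 / 2) * \<rho>1 (t n + x / s n))) \<partial>lborel)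
         + (\<integral>\<^sup>+x\<in>{x. \<bar>x\<bar> > s n * \<delta>}. ennreal (F x * \<rho> (t n + x / s n) * exp (- x\<^sup>2 / 2)) \<partial>lborel))
       \<longlonglongrightarrow> (\<integral>\<^sup>+x. ennreal (G x * (exp (- x\<^sup>2 / 2) * \<rho> \<theta>0)) \<partial>lborel)"
      using tendsto_add[OF lim1 tail] by simp
  qed
qed

text \<open>The integrands need not converge; a convergent minorant at almost every point suffices. This form
covers losses whose shift converges as well as losses whose shift escapes to infinity.\<close>

lemma gaussian_tilted_fatou:
  fixes s t :: "nat \<Rightarrow> real" and \<rho> H :: "real \<Rightarrow> real" and g :: "nat \<Rightarrow> real \<Rightarrow> real"
  assumes s_lim: "filterlim s at_top sequentially" and t_lim: "t \<longlonglongrightarrow> \<theta>0"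
    and rho_meas[measurable]: "\<rho> \<in> borel_measurable borel" and rho_nonneg: "\<And>x. 0 \<le> \<rho> x"
    and rho_cont: "isCont \<rho> \<theta>0"
    and g_meas[measurable]: "\<And>n. g n \<in> borel_measurable borel"
    and H: "AE x in lborel. \<exists>h. h \<longlonglongrightarrow> H x \<and> (\<forall>\<^sub>F n in sequentially. h n \<le> g n x)"
  shows "(\<integral>\<^sup>+x. ennreal (H x * (exp (- x\<^sup>2 / 2) * \<rho> \<theta>0)) \<partial>lborel)
     \<le> liminf (\<lambda>n. \<integral>\<^sup>+x. ennreal (g n x * (exp (- x\<^sup>2 / 2) * \<rho> (t n + x / s n))) \<partial>lborel)"
proof -
  have arg_lim: "(\<lambda>n. t n + x / s n) \<longlonglongrightarrow> \<theta>0" for x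
    using tendsto_add[OF t_lim tendsto_divide_0[OF tendsto_const filterlim_at_top_imp_at_infinity[OF s_lim], of x]]
    by simp
  have "(\<integral>\<^sup>+x. ennreal (H x * (exp (- x\<^sup>2 / 2) * \<rho> \<theta>0)) \<partial>lborel)
      \<le> (\<integral>\<^sup>+x. liminf (\<lambda>n. ennreal (g n x * (exp (- x\<^sup>2 / 2) * \<rho> (t n + x / s n)))) \<partial>lborel)"
  proof (rule nn_integral_mono_AE)
    show "AE x in lborel. ennreal (H x * (exp (- x\<^sup>2 / 2) * \<rho> \<theta>0))
       \<le> liminf (\<lambda>n. ennreal (g n x * (exp (- x\<^sup>2 / 2) * \<rho> (t n + x / s n))))"
      using H
    proof eventually_elim
      case (elim x)
      then obtain h where h: "h \<longlonglongrightarrow> H x" "\<forall>\<^sub>F n in sequentially. h n \<le> g n x" by blast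
      have "(\<lambda>n. ennreal (h n * (exp (- x\<^sup>2 / 2) * \<rho> (t n + x / s n))))
              \<longlonglongrightarrow> ennreal (H x * (exp (- x\<^sup>2 / 2) * \<rho> \<theta>0))"
        by (intro tendsto_ennrealI tendsto_mult tendsto_const h isCont_tendsto_compose[OF rho_cont arg_lim])
      then have "ennreal (H x * (exp (- x\<^sup>2 / 2) * \<rho> \<theta>0))
          = liminf (\<lambda>n. ennreal (h n * (exp (- x\<^sup>2 / 2) * \<rho> (t n + x / s n))))"
        by (intro lim_imp_Liminf[symmetric]) auto
      also have "\<dots> \<le> liminf (\<lambda>n. ennreal (g n x * (exp (- x\<^sup>2 / 2) * \<rho> (t n + x / s n))))"
        using h(2) by (intro Liminf_mono) (auto elim!: eventually_mono intro!: ennreal_leI mult_right_mono mult_nonneg_nonneg rho_nonneg)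
      finally show ?case .
    qed
  qed
  also have "\<dots> \<le> liminf (\<lambda>n. \<integral>\<^sup>+x. ennreal (g n x * (exp (- x\<^sup>2 / 2) * \<rho> (t n + x / s n))) \<partial>lborel)"
    by (rule nn_integral_liminf) measurable
  finally show ?thesis .
qed

lemma nn_integral_gaussian_kernel: "(\<integral>\<^sup>+x. ennreal (exp (- (x\<^sup>2 / 2))) \<partial>lborel) = ennreal (sqrt (2 * pi))"
proof -
  have "(\<integral>\<^sup>+x. ennreal (exp (- (x\<^sup>2 / 2))) \<partial>lborel)
      = (\<integral>\<^sup>+x. ennreal (sqrt (2 * pi)) * ennreal (std_normal_density x) \<partial>lborel)"
    by (intro nn_integral_cong) (auto simp: ennreal_mult'[symmetric] std_normal_density_def)
  also have "\<dots> = ennreal (sqrt (2 * pi)) * (\<integral>\<^sup>+x. ennreal (std_normal_density x) \<partial>lborel)"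
    by (rule nn_integral_cmult) measurable
  also have "(\<integral>\<^sup>+x. ennreal (std_normal_density x) \<partial>lborel) = 1"
    by (subst nn_integral_eq_integral) auto
  finally show ?thesis by simp
qed

section \<open>The posterior in the local parameter\<close>

text \<open>Substitution \<open>\<eta> = t + x / sqrt I\<close>, here and in the next lemma. A prior vanishes on the negative half-line,
which is why the integrals may run over the whole line.\<close>

lemma post_normaliser_rescaled:
  assumes rho: "\<rho> \<in> prior_class" and I: "I > 0"
    and int: "set_integrable lborel {0<..} (post_weight I t \<rho>)"
  shows "ennreal (LINT \<eta>:{0<..}|lborel. post_weight I t \<rho> \<eta>)
     = (\<integral>\<^sup>+x. ennreal (exp (- x\<^sup>2 / 2) * \<rho> (t + x / sqrt I)) \<partial>lborel) / ennreal (sqrt I)"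
proof -
  have [measurable]: "\<rho> \<in> borel_measurable borel" and rho0: "\<And>x. 0 \<le> \<rho> x" "\<And>x. x \<le> 0 \<Longrightarrow> \<rho> x = 0"
    using rho by (auto simp: prior_class_def)
  have "ennreal (LINT \<eta>:{0<..}|lborel. post_weight I t \<rho> \<eta>)
      = (\<integral>\<^sup>+\<eta>. ennreal (indicator {0<..} \<eta> *\<^sub>R post_weight I t \<rho> \<eta>) \<partial>lborel)"
    unfolding set_lebesgue_integral_def using int rho0
    by (intro nn_integral_eq_integral[symmetric]) (auto simp: set_integrable_def post_weight_def)
  also have "\<dots> = (\<integral>\<^sup>+\<eta>. ennreal (exp (- (I * (\<eta> - t)\<^sup>2 / 2)) * \<rho> \<eta>) \<partial>lborel)"
    using rho0 by (intro nn_integral_cong) (auto simp: post_weight_def indicator_def)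
  also have "\<dots> = ennreal (1 / sqrt I) *
       (\<integral>\<^sup>+x. ennreal (exp (- (I * (t + 1 / sqrt I * x - t)\<^sup>2 / 2)) * \<rho> (t + 1 / sqrt I * x)) \<partial>lborel)"
    using I by (subst nn_integral_real_affine[where t=t and c="1 / sqrt I"]) auto
  also have "\<dots> = ennreal (1 / sqrt I) *
       (\<integral>\<^sup>+x. ennreal (exp (- x\<^sup>2 / 2) * \<rho> (t + x / sqrt I)) \<partial>lborel)"
    using I by (simp add: power_divide)
  also have "\<dots> = (\<integral>\<^sup>+x. ennreal (exp (- x\<^sup>2 / 2) * \<rho> (t + x / sqrt I)) \<partial>lborel) / ennreal (sqrt I)"
  proof -
    have "inverse (ennreal (sqrt I)) = ennreal (1 / sqrt I)"
      using I by (simp add: inverse_ennreal inverse_eq_divide)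
    then show ?thesis
      unfolding divide_ennreal_def by (simp only: mult.commute)
  qed
  finally show ?thesis .
qed

lemma posterior_risk_rescaled:
  assumes rho: "\<rho> \<in> prior_class" and l: "l \<in> loss_class" and I: "I > 0"
    and int: "set_integrable lborel {0<..} (post_weight I t \<rho>)"
    and pos: "(LINT \<eta>:{0<..}|lborel. post_weight I t \<rho> \<eta>) > 0"
  shows "posterior_risk l (post_density I t \<rho>) b =
     (\<integral>\<^sup>+x. ennreal (l ((x - sqrt I * (b - t)) / sqrt I) * (exp (- x\<^sup>2 / 2) * \<rho> (t + x / sqrt I))) \<partial>lborel)
     / (\<integral>\<^sup>+x. ennreal (exp (- x\<^sup>2 / 2) * \<rho> (t + x / sqrt I)) \<partial>lborel)"
proof -
  have [measurable]: "\<rho> \<in> borel_measurable borel" and rho0: "\<And>x. 0 \<le> \<rho> x" "\<And>x. x \<le> 0 \<Longrightarrow> \<rho> x = 0"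
    using rho by (auto simp: prior_class_def)
  note [measurable] = loss_class_measurable[OF l]
  note l0 = loss_class_nonneg[OF l]
  define D where "D = (LINT \<eta>:{0<..}|lborel. post_weight I t \<rho> \<eta>)"
  define C where "C = (\<integral>\<^sup>+x. ennreal (exp (- x\<^sup>2 / 2) * \<rho> (t + x / sqrt I)) \<partial>lborel)"
  have D: "ennreal D = C / ennreal (sqrt I)" "D > 0"
    unfolding D_def C_def using post_normaliser_rescaled[OF rho I int] pos by auto
  have C: "C = ennreal (sqrt I * D)"
  proof -
    have "ennreal (sqrt I * D) = ennreal (sqrt I) * (C / ennreal (sqrt I))"
      using I D by (simp add: ennreal_mult)
    also have "\<dots> = C"
      using I by (simp add: ennreal_times_divide mult.commute ennreal_mult_divide_eq)
    finally show ?thesis ..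
  qed
  have "posterior_risk l (post_density I t \<rho>) b
     = (\<integral>\<^sup>+\<eta>. ennreal (1 / D) * ennreal (l (\<eta> - b) * (exp (- (I * (\<eta> - t)\<^sup>2 / 2)) * \<rho> \<eta>)) \<partial>lborel)"
    unfolding posterior_risk_def post_density_def D_def[symmetric]
    using rho0 l0 D by (intro nn_integral_cong)
      (auto simp: post_weight_def indicator_def ennreal_mult'[symmetric])
  also have "\<dots> = ennreal (1 / D) * (\<integral>\<^sup>+\<eta>. ennreal (l (\<eta> - b) * (exp (- (I * (\<eta> - t)\<^sup>2 / 2)) * \<rho> \<eta>)) \<partial>lborel)"
    by (rule nn_integral_cmult) measurable
  also have "\<dots> = ennreal (1 / D) * (ennreal (1 / sqrt I) * (\<integral>\<^sup>+x. ennreal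
      (l (t + 1 / sqrt I * x - b) * (exp (- (I * (t + 1 / sqrt I * x - t)\<^sup>2 / 2)) * \<rho> (t + 1 / sqrt I * x))) \<partial>lborel))"
    using I by (subst nn_integral_real_affine[where t=t and c="1 / sqrt I"]) auto
  also have "\<dots> = ennreal (1 / D) * (ennreal (1 / sqrt I) * (\<integral>\<^sup>+x. ennreal (l ((x - sqrt I * (b - t)) / sqrt I) * (exp (- x\<^sup>2 / 2) * \<rho> (t + x / sqrt I))) \<partial>lborel))"
  proof -
    have "t + 1 / sqrt I * x - b = (x - sqrt I * (b - t)) / sqrt I" for x
      using I by (simp add: field_simps)
    then show ?thesis
      using I by (simp add: power_divide)
  qed
  also have "\<dots> = (\<integral>\<^sup>+x. ennreal (l ((x - sqrt I * (b - t)) / sqrt I) * (exp (- x\<^sup>2 / 2) * \<rho> (t + x / sqrt I))) \<partial>lborel) / C"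
  proof -
    have "inverse (ennreal (sqrt I * D)) = ennreal (1 / D) * ennreal (1 / sqrt I)"
      using I D by (simp add: inverse_ennreal ennreal_mult[symmetric] inverse_eq_divide mult.commute)
    then show ?thesis
      unfolding C divide_ennreal_def by (simp only: mult_ac)
  qed
  finally show ?thesis unfolding C_def .
qed

text \<open>The deterministic heart of the matter: along a fixed realisation, \<open>t\<close> is the maximum likelihood
estimator and \<open>b\<close> the Bayesian one. The proof compares the risk of \<open>b\<close> with that of \<open>t\<close> and with
the Fatou bounds along all subsequences for which the local error \<open>r\<close> converges in the extended reals.\<close>

lemma rescaled_bayes_limit:
  fixes I t a b :: "nat \<Rightarrow> real" and \<rho> l l' f :: "real \<Rightarrow> real"
  assumes I_pos: "\<And>n. I n > 0" and I_lim: "filterlim I at_top sequentially"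
    and t_lim: "t \<longlonglongrightarrow> \<theta>0" and theta0: "\<theta>0 > 0"
    and prior: "\<rho> \<in> prior_class" and rho_cont: "isCont \<rho> \<theta>0" and rho_pos: "\<rho> \<theta>0 > 0"
    and delta: "\<delta> > 0" and B: "\<And>x. x \<in> cball \<theta>0 (2 * \<delta>) \<Longrightarrow> \<rho> x \<le> B"
    and den_int: "\<And>n. set_integrable lborel {0<..} (post_weight (I n) (t n) \<rho>)"
    and den_pos: "\<And>n. (LINT \<eta>:{0<..}|lborel. post_weight (I n) (t n) \<rho> \<eta>) > 0"
    and loss: "l \<in> loss_class" and loss': "l' \<in> loss_class"
    and a_pos: "\<And>n. a n > 0"
    and f_meas[measurable]: "f \<in> borel_measurable borel"
    and f_int: "(\<integral>\<^sup>+x. ennreal (f x * exp (- x\<^sup>2 / 2)) \<partial>lborel) < \<infinity>"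
    and dom: "\<And>n x. a n * l (x / sqrt (I n)) \<le> f x"
    and unif: "\<And>K. uniform_limit (cball 0 K) (\<lambda>n x. a n * l (x / sqrt (I n))) l' sequentially"
    and tail: "(\<lambda>n. \<integral>\<^sup>+x\<in>{x. \<bar>x\<bar> > sqrt (I n) * \<delta>}.
                 ennreal (f x * \<rho> (t n + x / sqrt (I n)) * exp (- x\<^sup>2 / 2)) \<partial>lborel) \<longlonglongrightarrow> 0"
    and strict: "strict_min_at (\<lambda>r. \<integral>\<^sup>+x. ennreal (l' (x + r) * exp (- x\<^sup>2 / 2)) \<partial>lborel) UNIV 0"
    and bayes: "\<And>n. strict_min_at (posterior_risk l (post_density (I n) (t n) \<rho>)) {0<..} (b n)"
  shows "(\<lambda>n. sqrt (I n) * (b n - t n)) \<longlonglongrightarrow> 0" (is ?bayes_mle)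
    and "(\<lambda>n. ennreal (a n) * posterior_risk l (post_density (I n) (t n) \<rho>) (b n))
           \<longlonglongrightarrow> (\<integral>\<^sup>+x. ennreal (l' x * (exp (- x\<^sup>2 / 2) / sqrt (2 * pi))) \<partial>lborel)" (is ?risk)
proof -
  define s where "s n = sqrt (I n)" for n
  define r where "r n = s n * (b n - t n)" for n
  define num where "num n y = (\<integral>\<^sup>+x. ennreal (a n * l ((x - y) / s n) * (exp (- x\<^sup>2 / 2) * \<rho> (t n + x / s n))) \<partial>lborel)"
    for n y
  define C where "C n = (\<integral>\<^sup>+x. ennreal (exp (- x\<^sup>2 / 2) * \<rho> (t n + x / s n)) \<partial>lborel)" for n
  define K where "K y = (\<integral>\<^sup>+x. ennreal (l' (x + y) * exp (- x\<^sup>2 / 2)) \<partial>lborel)" for y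
  have [measurable]: "\<rho> \<in> borel_measurable borel" "l \<in> borel_measurable borel" "l' \<in> borel_measurable borel"
    using prior loss loss' by (auto simp: prior_class_def loss_class_def)
  have rho_nonneg: "0 \<le> \<rho> x" for x
    using prior by (auto simp: prior_class_def)
  note l0 = loss_class_nonneg[OF loss] and l'0 = loss_class_nonneg[OF loss']
  have s_pos: "s n > 0" for n
    using I_pos by (simp add: s_def)
  have s_lim: "filterlim s at_top sequentially"
    unfolding s_def by (rule filterlim_compose[OF sqrt_at_top I_lim])
  have pull: "(\<integral>\<^sup>+x. ennreal (H x * (exp (- x\<^sup>2 / 2) * \<rho> \<theta>0)) \<partial>lborel)
      = ennreal (\<rho> \<theta>0) * (\<integral>\<^sup>+x. ennreal (H x * exp (- x\<^sup>2 / 2)) \<partial>lborel)"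
    if [measurable]: "H \<in> borel_measurable borel" for H
    using rho_pos by (subst nn_integral_cmult[symmetric]) (auto intro!: nn_integral_cong simp: ennreal_mult'[symmetric] ac_simps)
  have K_min: "K 0 < K y" if "y \<noteq> 0" for y
    using strict that by (auto simp: strict_min_at_def K_def)
  have l'_lim: "(\<lambda>n. a n * l (x / s n)) \<longlonglongrightarrow> l' x" for x
    unfolding s_def using tendsto_uniform_limitI[OF unif[of "\<bar>x\<bar>"], of x] by simp
  have l'_le_f: "l' x \<le> f x" for x
    by (rule LIMSEQ_le_const2[OF l'_lim]) (auto intro: dom simp: s_def)
  have K0_fin: "K 0 < \<infinity>"
  proof -
    have "K 0 \<le> (\<integral>\<^sup>+x. ennreal (f x * exp (- x\<^sup>2 / 2)) \<partial>lborel)"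
      unfolding K_def by (auto intro!: nn_integral_mono ennreal_leI mult_right_mono l'_le_f)
    then show ?thesis using f_int by (rule le_less_trans)
  qed
  have C_eq: "C n = ennreal (s n * (LINT \<eta>:{0<..}|lborel. post_weight (I n) (t n) \<rho> \<eta>))" (is "_ = ennreal (_ * ?D n)") for n
  proof -
    have "ennreal (s n * ?D n) = ennreal (s n) * (C n / ennreal (s n))"
      using post_normaliser_rescaled[OF prior I_pos den_int, of n] den_pos[of n] s_pos[of n]
      by (simp add: ennreal_mult s_def C_def)
    also have "\<dots> = C n"
      using s_pos[of n] by (simp add: ennreal_times_divide mult.commute ennreal_mult_divide_eq)
    finally show ?thesis ..
  qed
  define c where "c n = s n * (LINT \<eta>:{0<..}|lborel. post_weight (I n) (t n) \<rho> \<eta>)" for n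
  have c: "C n = ennreal (c n)" "c n > 0" for n
    using C_eq s_pos den_pos by (auto simp: c_def)
  have risk_eq: "ennreal (a n) * posterior_risk l (post_density (I n) (t n) \<rho>) y
      = num n (s n * (y - t n)) * ennreal (1 / c n)" for n y
  proof -
    have "ennreal (a n) * (\<integral>\<^sup>+x. ennreal (l ((x - s n * (y - t n)) / s n) * (exp (- x\<^sup>2 / 2) * \<rho> (t n + x / s n))) \<partial>lborel)
      = num n (s n * (y - t n))"
      unfolding num_def using a_pos[of n]
      by (subst nn_integral_cmult[symmetric]) (auto intro!: nn_integral_cong simp: ennreal_mult'[symmetric] ac_simps)
    moreover have "inverse (C n) = ennreal (1 / c n)"
      using c by (simp add: inverse_ennreal inverse_eq_divide)
    ultimately show ?thesis
      using posterior_risk_rescaled[OF prior loss I_pos den_int den_pos, of n y]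
      unfolding s_def[symmetric] C_def[symmetric] divide_ennreal_def by (simp only: mult.assoc[symmetric])
  qed
  \<comment> \<open>The tail condition speaks of \<open>f\<close>, but it also controls the mass of the prior: \<open>f\<close> dominates \<open>l'\<close>,
and \<open>l'\<close> is at least \<open>l' y > 0\<close> outside \<open>[-\<bar>y\<bar>, \<bar>y\<bar>]\<close> for a suitable \<open>y\<close>, since it is not identically zero.\<close>
  have c_lim: "c \<longlonglongrightarrow> \<rho> \<theta>0 * sqrt (2 * pi)"
  proof -
    obtain y where y: "l' y > 0"
    proof (rule ccontr)
      assume "\<not> thesis"
      then have "l' = (\<lambda>_. 0)"
        using that l'0 by (intro ext) (metis order_le_less)
      then show False using K_min[of 1] by (simp add: K_def)
    qed
    have far: "l' y \<le> f x" if "\<bar>y\<bar> \<le> \<bar>x\<bar>" for x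
      using loss_class_mono[OF loss' that] l'_le_f[of x] by simp
    have tail1: "(\<lambda>n. \<integral>\<^sup>+x\<in>{x. \<bar>x\<bar> > s n * \<delta>}.
                 ennreal (1 * \<rho> (t n + x / s n) * exp (- x\<^sup>2 / 2)) \<partial>lborel) \<longlonglongrightarrow> 0"
    proof (rule tendsto_sandwich[OF _ _ tendsto_const])
      have "\<forall>\<^sub>F n in sequentially. s n \<ge> \<bar>y\<bar> / \<delta>"
        using s_lim by (auto simp: filterlim_at_top)
      then show "\<forall>\<^sub>F n in sequentially.
          (\<integral>\<^sup>+x\<in>{x. \<bar>x\<bar> > s n * \<delta>}. ennreal (1 * \<rho> (t n + x / s n) * exp (- x\<^sup>2 / 2)) \<partial>lborel)
          \<le> ennreal (1 / l' y) * (\<integral>\<^sup>+x\<in>{x. \<bar>x\<bar> > s n * \<delta>}.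
                 ennreal (f x * \<rho> (t n + x / s n) * exp (- x\<^sup>2 / 2)) \<partial>lborel)"
      proof eventually_elim
        case (elim n)
        have "ennreal (1 * \<rho> (t n + x / s n) * exp (- x\<^sup>2 / 2)) * indicator {x. \<bar>x\<bar> > s n * \<delta>} x
          \<le> ennreal (1 / l' y) * (ennreal (f x * \<rho> (t n + x / s n) * exp (- x\<^sup>2 / 2)) * indicator {x. \<bar>x\<bar> > s n * \<delta>} x)" for x
        proof (cases "\<bar>x\<bar> > s n * \<delta>")
          case True
          then have "\<bar>y\<bar> \<le> \<bar>x\<bar>"
            using elim delta by (simp add: field_simps)
          then have "1 \<le> 1 / l' y * f x"
            using far[of x] y by simp
          then have "1 * (\<rho> (t n + x / s n) * exp (- x\<^sup>2 / 2)) \<le> (1 / l' y * f x) * (\<rho> (t n + x / s n) * exp (- x\<^sup>2 / 2))"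
            using rho_nonneg by (intro mult_right_mono) auto
          then show ?thesis
            using True y by (auto simp: ennreal_mult'[symmetric] intro!: ennreal_leI)
        qed auto
        then show ?case
          by (subst nn_integral_cmult[symmetric]) (auto intro!: nn_integral_mono)
      qed
      show "(\<lambda>n. ennreal (1 / l' y) * (\<integral>\<^sup>+x\<in>{x. \<bar>x\<bar> > s n * \<delta>}.
                 ennreal (f x * \<rho> (t n + x / s n) * exp (- x\<^sup>2 / 2)) \<partial>lborel)) \<longlonglongrightarrow> 0"
        using ennreal_tendsto_cmult[OF _ tail, of "ennreal (1 / l' y)"] by (simp add: s_def)
    qed auto
    have "C \<longlonglongrightarrow> (\<integral>\<^sup>+x. ennreal (1 * (exp (- x\<^sup>2 / 2) * \<rho> \<theta>0)) \<partial>lborel)"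
      using gaussian_tilted_limit[OF s_pos s_lim t_lim _ rho_nonneg rho_cont delta B, where g="\<lambda>_ _. 1" and F="\<lambda>_. 1" and G="\<lambda>_. 1"]
        tail1 by (simp add: nn_integral_gaussian_kernel C_def[abs_def])
    also have "(\<integral>\<^sup>+x. ennreal (1 * (exp (- x\<^sup>2 / 2) * \<rho> \<theta>0)) \<partial>lborel) = ennreal (\<rho> \<theta>0 * sqrt (2 * pi))"
      using rho_pos by (subst pull) (auto simp: nn_integral_gaussian_kernel ennreal_mult')
    finally show ?thesis
      using rho_pos c unfolding c(1)[abs_def]
      by (subst (asm) tendsto_ennreal_iff) (auto intro: always_eventually less_imp_le)
  qed
  have mle_risk: "(\<lambda>n. num n 0) \<longlonglongrightarrow> ennreal (\<rho> \<theta>0) * K 0"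
    using gaussian_tilted_limit[OF s_pos s_lim t_lim _ rho_nonneg rho_cont delta B, where g="\<lambda>n x. a n * l (x / s n)" and F=f and G=l']
      tail f_int dom a_pos l0 l'_lim pull[of l'] by (simp add: num_def K_def s_def less_imp_le)
  have comp: "\<forall>\<^sub>F n in sequentially. num n (r n) \<le> num n 0"
    using order_tendstoD(1)[OF t_lim theta0]
  proof eventually_elim
    case (elim n)
    have "posterior_risk l (post_density (I n) (t n) \<rho>) (b n) \<le> posterior_risk l (post_density (I n) (t n) \<rho>) (t n)"
      using bayes[of n] elim by (cases "t n = b n") (auto simp: strict_min_at_def less_imp_le)
    then have "num n (r n) * ennreal (1 / c n) \<le> num n 0 * ennreal (1 / c n)"
      using risk_eq[of n "b n"] risk_eq[of n "t n"] by (simp add: r_def[symmetric]) (metis mult_left_mono zero_le)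
    then have "ennreal (1 / c n) * num n (r n) \<le> ennreal (1 / c n) * num n 0"
      by (simp add: mult.commute)
    then show ?case
      using c(2)[of n] by (subst (asm) ennreal_mult_le_mult_iff) auto
  qed
  have fatou: "ennreal (\<rho> \<theta>0) * (\<integral>\<^sup>+x. ennreal (H x * exp (- x\<^sup>2 / 2)) \<partial>lborel) \<le> liminf (\<lambda>n. num (k n) (r (k n)))"
    if k: "strict_mono k" and [measurable]: "H \<in> borel_measurable borel"
      and H: "AE x in lborel. \<exists>h. h \<longlonglongrightarrow> H x \<and> (\<forall>\<^sub>F n in sequentially. h n \<le> a (k n) * l ((x - r (k n)) / s (k n)))"
    for k H
  proof -
    have "(\<integral>\<^sup>+x. ennreal (H x * (exp (- x\<^sup>2 / 2) * \<rho> \<theta>0)) \<partial>lborel) \<le> liminf (\<lambda>n. num (k n) (r (k n)))"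
      unfolding num_def
      by (rule gaussian_tilted_fatou[OF filterlim_compose[OF s_lim filterlim_subseq[OF k]]
            LIMSEQ_subseq_LIMSEQ[OF t_lim k, unfolded o_def] _ rho_nonneg rho_cont _ H]) measurable
    then show ?thesis using pull[of H] by simp
  qed
  have fatou_le: "(\<integral>\<^sup>+x. ennreal (H x * exp (- x\<^sup>2 / 2)) \<partial>lborel) \<le> K 0"
    if k: "strict_mono k" and H_meas: "H \<in> borel_measurable borel"
      and H: "AE x in lborel. \<exists>h. h \<longlonglongrightarrow> H x \<and> (\<forall>\<^sub>F n in sequentially. h n \<le> a (k n) * l ((x - r (k n)) / s (k n)))"
    for k H
  proof -
    note fatou[OF that]
    also have "liminf (\<lambda>n. num (k n) (r (k n))) \<le> liminf (\<lambda>n. num (k n) 0)"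
      using eventually_subseq[OF k comp] by (intro Liminf_mono) simp
    also have "\<dots> = ennreal (\<rho> \<theta>0) * K 0"
      using LIMSEQ_subseq_LIMSEQ[OF mle_risk k] by (intro lim_imp_Liminf) (auto simp: o_def)
    finally show ?thesis
      using rho_pos by (subst (asm) ennreal_mult_le_mult_iff) auto
  qed
  \<comment> \<open>If the local errors converge to a finite \<open>R\<close>, the scaled losses converge wherever the shifted
\<open>l'\<close> is continuous, by locally uniform convergence.\<close>
  have finite_H: "AE x in lborel. \<exists>h. h \<longlonglongrightarrow> l' (x - R) \<and> (\<forall>\<^sub>F n in sequentially. h n \<le> a (k n) * l ((x - r (k n)) / s (k n)))"
    if k: "strict_mono k" and R: "(\<lambda>n. r (k n)) \<longlonglongrightarrow> R" for k R
    using loss_class_AE_isCont[OF loss', of R]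
  proof eventually_elim
    case (elim x)
    have y_lim: "(\<lambda>n. x - r (k n)) \<longlonglongrightarrow> x - R"
      by (intro tendsto_intros R)
    then have "Bseq (\<lambda>n. x - r (k n))"
      by (intro convergent_imp_Bseq convergentI)
    then obtain Y where Y: "\<And>n. x - r (k n) \<in> cball 0 Y"
      by (auto simp: Bseq_def)
    have "(\<lambda>n. a (k n) * l ((x - r (k n)) / s (k n)) - l' (x - r (k n))) \<longlonglongrightarrow> 0"
    proof (rule tendstoI)
      fix e :: real assume "e > 0"
      then have "\<forall>\<^sub>F n in sequentially. \<forall>x\<in>cball 0 Y. dist (a n * l (x / s n)) (l' x) < e"
        using uniform_limitD[OF unif[of Y]] by (simp add: s_def)
      from eventually_subseq[OF k this]
      show "\<forall>\<^sub>F n in sequentially. dist (a (k n) * l ((x - r (k n)) / s (k n)) - l' (x - r (k n))) 0 < e"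
        by eventually_elim (use Y in \<open>auto simp: dist_real_def\<close>)
    qed
    from tendsto_add[OF this isCont_tendsto_compose[OF elim y_lim]]
    show ?case by (intro exI[of _ "\<lambda>n. a (k n) * l ((x - r (k n)) / s (k n))"]) auto
  qed
  have sublim: "R = 0" if k: "strict_mono k" and R: "(\<lambda>n. ereal (r (k n))) \<longlonglongrightarrow> R" for k R
  proof -
    consider R' where "R = ereal R'" | "\<bar>R\<bar> = \<infinity>" by (cases R) auto
    then show ?thesis
    proof cases
      case 1
      then have "(\<lambda>n. r (k n)) \<longlonglongrightarrow> R'" using R by simp
      then have "K (- R') \<le> K 0"
        using fatou_le[OF k _ finite_H[OF k]] by (simp add: K_def)
      then have "R' = 0" using K_min[of "- R'"] by (cases "R' = 0") auto
      then show ?thesis using 1 by simp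
    next
      case 2
      \<comment> \<open>If the local errors escape, then \<open>\<bar>x - r\<bar>\<close> eventually exceeds every \<open>\<bar>y\<bar>\<close>, so the scaled loss has
the minorant \<open>l' y\<close>; thus every value of \<open>l'\<close> is at most its Gaussian mean \<open>\<kappa> / sqrt (2 * pi)\<close>,
and the shift by \<open>1\<close> contradicts strict minimality at \<open>0\<close>.\<close>
      have big: "\<forall>\<^sub>F n in sequentially. \<bar>r (k n)\<bar> > z" for z
      proof (cases R)
        case PInf
        with R have "\<forall>\<^sub>F n in sequentially. ereal z < ereal (r (k n))"
          by (simp add: tendsto_PInfty)
        then show ?thesis by eventually_elim auto
      next
        case MInf
        with R have "\<forall>\<^sub>F n in sequentially. ereal (r (k n)) < ereal (- z)"
          by (simp add: tendsto_MInfty)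
        then show ?thesis by eventually_elim auto
      qed (use 2 in auto)
      have le: "ennreal (l' y) * ennreal (sqrt (2 * pi)) \<le> K 0" for y
      proof -
        have "(\<integral>\<^sup>+x. ennreal (l' y * exp (- x\<^sup>2 / 2)) \<partial>lborel) \<le> K 0"
        proof (rule fatou_le[OF k])
          have "\<exists>h. h \<longlonglongrightarrow> l' y \<and> (\<forall>\<^sub>F n in sequentially. h n \<le> a (k n) * l ((x - r (k n)) / s (k n)))" for x
          proof (intro exI conjI)
            show "(\<lambda>n. a (k n) * l (y / s (k n))) \<longlonglongrightarrow> l' y"
              using LIMSEQ_subseq_LIMSEQ[OF l'_lim k] by (simp add: o_def)
            show "\<forall>\<^sub>F n in sequentially. a (k n) * l (y / s (k n)) \<le> a (k n) * l ((x - r (k n)) / s (k n))"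
              using big[of "\<bar>x\<bar> + \<bar>y\<bar>"]
            proof eventually_elim
              case (elim n)
              then have "\<bar>y / s (k n)\<bar> \<le> \<bar>(x - r (k n)) / s (k n)\<bar>"
                using s_pos[of "k n"] by (simp add: abs_divide divide_right_mono)
              then show ?case
                using a_pos[of "k n"] by (intro mult_left_mono loss_class_mono[OF loss]) auto
            qed
          qed
          then show "AE x in lborel. \<exists>h. h \<longlonglongrightarrow> l' y \<and> (\<forall>\<^sub>F n in sequentially. h n \<le> a (k n) * l ((x - r (k n)) / s (k n)))"
            by simp
        qed auto
        then show ?thesis
          using l'0[of y] by (simp add: ennreal_mult' nn_integral_cmult nn_integral_gaussian_kernel del: ennreal_le_iff)
      qed
      define \<kappa> where "\<kappa> = enn2real (K 0)"
      have kappa: "K 0 = ennreal \<kappa>" "0 \<le> \<kappa>"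
        using K0_fin by (auto simp: \<kappa>_def)
      have le': "l' y \<le> \<kappa> / sqrt (2 * pi)" for y
        using le[of y] kappa l'0[of y] by (simp add: ennreal_mult'[symmetric] pos_le_divide_eq)
      have "K 1 \<le> (\<integral>\<^sup>+x. ennreal (\<kappa> / sqrt (2 * pi)) * ennreal (exp (- x\<^sup>2 / 2)) \<partial>lborel)"
      proof -
        have "ennreal (l' (x + 1) * exp (- x\<^sup>2 / 2)) \<le> ennreal (\<kappa> / sqrt (2 * pi)) * ennreal (exp (- x\<^sup>2 / 2))" for x
        proof (subst ennreal_mult'[symmetric])
          show "ennreal (l' (x + 1) * exp (- x\<^sup>2 / 2)) \<le> ennreal (\<kappa> / sqrt (2 * pi) * exp (- x\<^sup>2 / 2))"
            by (intro ennreal_leI mult_right_mono le') auto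
        qed (use kappa in auto)
        then show ?thesis
          unfolding K_def by (rule nn_integral_mono)
      qed
      also have "\<dots> = ennreal \<kappa>"
      proof (subst nn_integral_cmult)
        show "ennreal (\<kappa> / sqrt (2 * pi)) * (\<integral>\<^sup>+x. ennreal (exp (- x\<^sup>2 / 2)) \<partial>lborel) = ennreal \<kappa>"
          using kappa(2) by (simp add: nn_integral_gaussian_kernel ennreal_mult'[symmetric])
      qed measurable
      finally show ?thesis using K_min[of 1] kappa by simp
    qed
  qed
  have r_lim: "r \<longlonglongrightarrow> 0"
  proof -
    obtain k where "strict_mono k" "((\<lambda>n. ereal (r n)) \<circ> k) \<longlonglongrightarrow> limsup (\<lambda>n. ereal (r n))"
      using limsup_subseq_lim by blast
    then have "limsup (\<lambda>n. ereal (r n)) = 0"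
      using sublim[of k] by (simp add: o_def)
    moreover obtain k where "strict_mono k" "((\<lambda>n. ereal (r n)) \<circ> k) \<longlonglongrightarrow> liminf (\<lambda>n. ereal (r n))"
      using liminf_subseq_lim by blast
    then have "liminf (\<lambda>n. ereal (r n)) = 0"
      using sublim[of k] by (simp add: o_def)
    ultimately have "(\<lambda>n. ereal (r n)) \<longlonglongrightarrow> 0"
      by (intro Liminf_eq_Limsup) auto
    then show ?thesis by (simp add: zero_ereal_def)
  qed
  then show ?bayes_mle
    by (simp add: r_def[abs_def] s_def)
  have num_lim: "(\<lambda>n. num n (r n)) \<longlonglongrightarrow> ennreal (\<rho> \<theta>0) * K 0"
  proof -
    have lower: "ennreal (\<rho> \<theta>0) * K 0 \<le> liminf (\<lambda>n. num n (r n))"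
      using fatou[of "\<lambda>n. n", OF _ _ finite_H[of "\<lambda>n. n" 0]] r_lim by (simp add: K_def strict_mono_def)
    have upper: "limsup (\<lambda>n. num n (r n)) \<le> ennreal (\<rho> \<theta>0) * K 0"
    proof -
      have "limsup (\<lambda>n. num n (r n)) \<le> limsup (\<lambda>n. num n 0)"
        by (rule Limsup_mono[OF comp])
      also have "\<dots> = ennreal (\<rho> \<theta>0) * K 0"
        by (rule lim_imp_Limsup[OF _ mle_risk]) simp
      finally show ?thesis .
    qed
    have "liminf (\<lambda>n. num n (r n)) \<le> limsup (\<lambda>n. num n (r n))"
      by (rule Liminf_le_Limsup) simp
    with lower upper show ?thesis
      by (intro Liminf_eq_Limsup) auto
  qed
  have "(\<lambda>n. num n (r n) * ennreal (1 / c n)) \<longlonglongrightarrow> ennreal (\<rho> \<theta>0) * K 0 * ennreal (1 / (\<rho> \<theta>0 * sqrt (2 * pi)))"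
    using rho_pos K0_fin
    by (intro tendsto_mult_ennreal num_lim tendsto_ennrealI tendsto_divide tendsto_const c_lim)
       (auto simp: ennreal_mult_eq_top_iff less_top)
  also have "ennreal (\<rho> \<theta>0) * K 0 * ennreal (1 / (\<rho> \<theta>0 * sqrt (2 * pi))) = ennreal (1 / sqrt (2 * pi)) * K 0"
  proof -
    have "ennreal (\<rho> \<theta>0) * ennreal (1 / (\<rho> \<theta>0 * sqrt (2 * pi))) = ennreal (1 / sqrt (2 * pi))"
      using rho_pos by (simp add: ennreal_mult'[symmetric])
    then show ?thesis by (metis mult.assoc mult.commute)
  qed
  also have "\<dots> = (\<integral>\<^sup>+x. ennreal (l' x * (exp (- x\<^sup>2 / 2) / sqrt (2 * pi))) \<partial>lborel)"
    unfolding K_def by (subst nn_integral_cmult[symmetric]) (auto intro!: nn_integral_cong simp: ennreal_mult'[symmetric] ac_simps)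
  finally show ?risk
    by (simp add: risk_eq r_def)
qed

section \<open>Measurability of the Bayesian estimator\<close>

lemma posterior_risk_lower_semicontinuous:
  assumes l: "l \<in> loss_class" and [measurable]: "p \<in> borel_measurable borel"
    and p: "\<And>x. 0 \<le> p x" and X: "X \<longlonglongrightarrow> x"
  shows "posterior_risk l p x \<le> liminf (\<lambda>n. posterior_risk l p (X n))"
proof -
  note [measurable] = loss_class_measurable[OF l]
  have "posterior_risk l p x \<le> (\<integral>\<^sup>+\<eta>. liminf (\<lambda>n. ennreal (l (\<eta> - X n) * p \<eta>) * indicator {0<..} \<eta>) \<partial>lborel)"
    unfolding posterior_risk_def
  proof (rule nn_integral_mono_AE)
    show "AE \<eta> in lborel. ennreal (l (\<eta> - x) * p \<eta>) * indicator {0<..} \<eta>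
        \<le> liminf (\<lambda>n. ennreal (l (\<eta> - X n) * p \<eta>) * indicator {0<..} \<eta>)"
      using loss_class_AE_isCont[OF l, of x]
    proof eventually_elim
      case (elim \<eta>)
      have "(\<lambda>n. ennreal (l (\<eta> - X n) * p \<eta>)) \<longlonglongrightarrow> ennreal (l (\<eta> - x) * p \<eta>)"
        by (rule tendsto_ennrealI[OF tendsto_mult[OF isCont_tendsto_compose[OF elim tendsto_diff[OF tendsto_const X]] tendsto_const]])
      then have "(\<lambda>n. ennreal (l (\<eta> - X n) * p \<eta>) * indicator {0<..} \<eta>)
          \<longlonglongrightarrow> ennreal (l (\<eta> - x) * p \<eta>) * indicator {0<..} \<eta>"
        by (cases "\<eta> \<in> {0<..}") simp_all
      then show ?case
        by (simp add: lim_imp_Liminf)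
    qed
  qed
  also have "\<dots> \<le> liminf (\<lambda>n. posterior_risk l p (X n))"
    unfolding posterior_risk_def by (rule nn_integral_liminf) measurable
  finally show ?thesis .
qed

text \<open>Moving the estimate to the right decreases the loss at all \<open>\<eta>\<close> beyond the new estimate, while below
it the loss is bounded by its value at an upper bound of the estimates, because \<open>\<eta> > 0\<close>. Hence
the risk at \<open>x\<close> plus a constant dominates. From the left this fails: the risk can be infinite at all
smaller estimates.\<close>

lemma posterior_risk_right_continuous:
  assumes l: "l \<in> loss_class" and [measurable]: "p \<in> borel_measurable borel"
    and p: "\<And>x. 0 \<le> p x" and p_int: "(\<integral>\<^sup>+\<eta>\<in>{0<..}. ennreal (p \<eta>) \<partial>lborel) < \<infinity>"
    and x: "0 < x" and fin: "posterior_risk l p x < \<infinity>"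
    and X: "X \<longlonglongrightarrow> x" and X_ge: "\<And>n. x \<le> X n"
  shows "(\<lambda>n. posterior_risk l p (X n)) \<longlonglongrightarrow> posterior_risk l p x"
proof -
  note [measurable] = loss_class_measurable[OF l]
  have "Bseq X"
    using X by (intro convergent_imp_Bseq convergentI)
  then obtain Y where Y: "\<And>n. \<bar>X n\<bar> \<le> Y" by (auto simp: Bseq_def)
  have Y0: "0 \<le> l Y" by (rule loss_class_nonneg[OF l])
  let ?w = "\<lambda>\<eta>. ennreal (l (\<eta> - x) * p \<eta>) * indicator {0<..} \<eta> + ennreal (l Y) * (ennreal (p \<eta>) * indicator {0<..} \<eta>)"
  show ?thesis
    unfolding posterior_risk_def
  proof (rule nn_integral_dominated_convergence[where w="?w"])
    show "AE \<eta> in lborel. ennreal (l (\<eta> - X n) * p \<eta>) * indicator {0<..} \<eta> \<le> ?w \<eta>" for n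
    proof (intro AE_I2)
      fix \<eta> :: real
      show "ennreal (l (\<eta> - X n) * p \<eta>) * indicator {0<..} \<eta> \<le> ?w \<eta>"
      proof (cases "\<eta> \<in> {0<..}")
        case True
        have "l (\<eta> - X n) \<le> l (\<eta> - x) + l Y"
        proof (cases "X n \<le> \<eta>")
          case True
          then have "l (\<eta> - X n) \<le> l (\<eta> - x)"
            using X_ge[of n] by (intro loss_class_mono[OF l]) auto
          then show ?thesis using Y0 by simp
        next
          case False
          then have "l (\<eta> - X n) \<le> l Y"
            using Y[of n] \<open>\<eta> \<in> {0<..}\<close> by (intro loss_class_mono[OF l]) auto
          then show ?thesis using loss_class_nonneg[OF l, of "\<eta> - x"] by simp
        qed
        then have "l (\<eta> - X n) * p \<eta> \<le> (l (\<eta> - x) + l Y) * p \<eta>"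
          using p by (intro mult_right_mono) auto
        then have "ennreal (l (\<eta> - X n) * p \<eta>) \<le> ennreal (l (\<eta> - x) * p \<eta> + l Y * p \<eta>)"
          by (intro ennreal_leI) (simp add: algebra_simps)
        also have "\<dots> = ennreal (l (\<eta> - x) * p \<eta>) + ennreal (l Y) * ennreal (p \<eta>)"
          using loss_class_nonneg[OF l, of "\<eta> - x"] Y0 p by (simp add: ennreal_mult)
        finally show ?thesis using True by simp
      qed simp
    qed
    have "(\<integral>\<^sup>+\<eta>. ?w \<eta> \<partial>lborel) = posterior_risk l p x + ennreal (l Y) * (\<integral>\<^sup>+\<eta>\<in>{0<..}. ennreal (p \<eta>) \<partial>lborel)"
      unfolding posterior_risk_def by (subst nn_integral_add) (auto simp: nn_integral_cmult)
    also have "\<dots> < \<infinity>"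
      using fin p_int by (simp add: ennreal_mult_less_top)
    finally show "(\<integral>\<^sup>+\<eta>. ?w \<eta> \<partial>lborel) < \<infinity>" .
    show "AE \<eta> in lborel. (\<lambda>n. ennreal (l (\<eta> - X n) * p \<eta>) * indicator {0<..} \<eta>)
        \<longlonglongrightarrow> ennreal (l (\<eta> - x) * p \<eta>) * indicator {0<..} \<eta>"
      using loss_class_AE_isCont[OF l, of x]
    proof eventually_elim
      case (elim \<eta>)
      have "(\<lambda>n. ennreal (l (\<eta> - X n) * p \<eta>)) \<longlonglongrightarrow> ennreal (l (\<eta> - x) * p \<eta>)"
        by (rule tendsto_ennrealI[OF tendsto_mult[OF isCont_tendsto_compose[OF elim tendsto_diff[OF tendsto_const X]] tendsto_const]])
      then show ?case
        by (cases "\<eta> \<in> {0<..}") simp_all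
    qed
  qed measurable
qed

text \<open>Right-continuity reduces the infimum over \<open>[u, v]\<close> to one over rationals and the right endpoint;
lower semicontinuity makes the infimum over the compact interval attained. So it equals the
global minimum exactly if the unique minimiser lies in the interval.\<close>

lemma strict_minimiser_in_interval_iff:
  fixes R :: "real \<Rightarrow> ennreal"
  assumes min: "strict_min_at R {0<..} b"
    and lsc: "\<And>X x. X \<longlonglongrightarrow> x \<Longrightarrow> R x \<le> liminf (\<lambda>n. R (X n))"
    and right: "\<And>X x. 0 < x \<Longrightarrow> R x < \<infinity> \<Longrightarrow> X \<longlonglongrightarrow> x \<Longrightarrow> (\<And>n. x \<le> X n) \<Longrightarrow> (\<lambda>n. R (X n)) \<longlonglongrightarrow> R x"
    and uv: "0 < u" "u \<le> v"
  shows "b \<in> {u..v} \<longleftrightarrow> (INF x\<in>insert v (\<rat> \<inter> {u..<v}). R x) \<le> (INF x\<in>\<rat> \<inter> {0<..}. R x)"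
proof -
  have b: "0 < b" and b_lt: "\<And>x. 0 < x \<Longrightarrow> x \<noteq> b \<Longrightarrow> R b < R x"
    using min by (auto simp: strict_min_at_def)
  have b_le: "R b \<le> R x" if "0 < x" for x
    using b_lt[OF that] by (cases "x = b") auto
  have b_fin: "R b < \<infinity>"
    using less_le_trans[OF b_lt[of "b + 1"] top_greatest] b by simp
  have near: "(INF x\<in>\<rat> \<inter> {b..<e}. R x) \<le> R b" if "b < e" for e
  proof -
    have "\<exists>x. x \<in> \<rat> \<and> b < x \<and> x < b + (e - b) / real (Suc n)" for n
      using Rats_dense_in_real[of b "b + (e - b) / real (Suc n)"] that by auto
    then obtain X where X: "\<And>n. X n \<in> \<rat>" "\<And>n. b < X n" "\<And>n. X n < b + (e - b) / real (Suc n)"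
      by metis
    have "(\<lambda>n. (e - b) * (1 / real (Suc n))) \<longlonglongrightarrow> (e - b) * 0"
      by (intro tendsto_mult tendsto_const LIMSEQ_Suc[OF lim_1_over_n])
    then have "(\<lambda>n. b + (e - b) / real (Suc n)) \<longlonglongrightarrow> b"
      using tendsto_add[OF tendsto_const, of _ 0 sequentially b] by simp
    then have "X \<longlonglongrightarrow> b"
      by (rule tendsto_sandwich[OF always_eventually always_eventually tendsto_const, rotated 2])
         (intro allI less_imp_le X)+
    then have lim: "(\<lambda>n. R (X n)) \<longlonglongrightarrow> R b"
      by (rule right[OF b b_fin]) (rule less_imp_le[OF X(2)])
    have "X n < e" for n
    proof -
      have "(e - b) / real (Suc n) \<le> (e - b) / 1"
        using that by (intro divide_left_mono) auto
      then show ?thesis using X(3)[of n] by simp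
    qed
    then have "(INF x\<in>\<rat> \<inter> {b..<e}. R x) \<le> R (X n)" for n
      using X by (intro INF_lower) (auto intro: less_imp_le)
    then show ?thesis
      by (intro LIMSEQ_le_const[OF lim]) auto
  qed
  have inf_all: "(INF x\<in>\<rat> \<inter> {0<..}. R x) = R b"
  proof (rule antisym)
    have "(INF x\<in>\<rat> \<inter> {0<..}. R x) \<le> (INF x\<in>\<rat> \<inter> {b..<b+1}. R x)"
      using b by (intro INF_superset_mono) auto
    also have "\<dots> \<le> R b" by (rule near) simp
    finally show "(INF x\<in>\<rat> \<inter> {0<..}. R x) \<le> R b" .
    show "R b \<le> (INF x\<in>\<rat> \<inter> {0<..}. R x)"
      by (intro INF_greatest b_le) auto
  qed
  let ?S = "insert v (\<rat> \<inter> {u..<v})"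
  show ?thesis
    unfolding inf_all
  proof
    assume bi: "b \<in> {u..v}"
    show "(INF x\<in>?S. R x) \<le> R b"
    proof (cases "b = v")
      case True
      then show ?thesis by (intro INF_lower) auto
    next
      case False
      have "(INF x\<in>?S. R x) \<le> (INF x\<in>\<rat> \<inter> {b..<v}. R x)"
        using bi by (intro INF_superset_mono) auto
      also have "\<dots> \<le> R b" using False bi by (intro near) auto
      finally show ?thesis .
    qed
  next
    assume le: "(INF x\<in>?S. R x) \<le> R b"
    obtain Z where Z: "\<And>n. Z n \<in> R ` ?S" "Z \<longlonglongrightarrow> (INF x\<in>?S. R x)"
      using Inf_as_limit[of "R ` ?S"] by blast
    have "\<exists>x. x \<in> ?S \<and> Z n = R x" for n
      using Z(1)[of n] by blast
    then obtain X where X: "\<And>n. X n \<in> ?S" "\<And>n. Z n = R (X n)"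
      by metis
    have "X n \<in> {u..v}" for n using X(1)[of n] uv by auto
    then obtain x k where x: "x \<in> {u..v}" "strict_mono k" "(X \<circ> k) \<longlonglongrightarrow> x"
      using compact_Icc[of u v] unfolding compact_def by blast
    have "R x \<le> liminf (\<lambda>n. R ((X \<circ> k) n))"
      by (rule lsc[OF x(3)])
    also have "\<dots> = liminf (Z \<circ> k)"
      using X(2) by (simp add: o_def)
    also have "\<dots> = (INF x\<in>?S. R x)"
      by (intro lim_imp_Liminf LIMSEQ_subseq_LIMSEQ[OF Z(2) x(2)]) simp
    also note le
    finally have "x = b" using b_lt[of x] x(1) uv by force
    then show "b \<in> {u..v}" using x by simp
  qed
qed

text \<open>Completeness is needed because the hypotheses on \<open>R\<close> and \<open>b\<close> hold only almost everywhere.\<close>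

lemma borel_measurable_strict_minimiser:
  fixes R :: "'a \<Rightarrow> real \<Rightarrow> ennreal" and b :: "'a \<Rightarrow> real"
  assumes complete: "complete_measure M"
    and meas[measurable]: "\<And>x. (\<lambda>\<omega>. R \<omega> x) \<in> borel_measurable M"
    and min: "AE \<omega> in M. strict_min_at (R \<omega>) {0<..} (b \<omega>)"
    and lsc: "AE \<omega> in M. \<forall>X x. X \<longlonglongrightarrow> x \<longrightarrow> R \<omega> x \<le> liminf (\<lambda>n. R \<omega> (X n))"
    and right: "AE \<omega> in M. \<forall>X x. 0 < x \<longrightarrow> R \<omega> x < \<infinity> \<longrightarrow> X \<longlonglongrightarrow> x \<longrightarrow> (\<forall>n. x \<le> X n) \<longrightarrow>
                (\<lambda>n. R \<omega> (X n)) \<longlonglongrightarrow> R \<omega> x"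
  shows "b \<in> borel_measurable M"
proof (rule borel_measurable_iff_le[THEN iffD2], intro allI)
  fix c :: real
  define A where "A = {\<omega> \<in> space M. \<exists>n. 1 / real (Suc n) \<le> c \<and>
     (INF x\<in>insert c (\<rat> \<inter> {1 / real (Suc n)..<c}). R \<omega> x) \<le> (INF x\<in>\<rat> \<inter> {0<..}. R \<omega> x)}"
  have [simp]: "countable (\<rat> \<inter> S)" for S :: "real set"
    using countable_rat by (rule countable_subset[rotated]) auto
  have [measurable]: "(\<lambda>\<omega>. INF x\<in>insert c (\<rat> \<inter> {1 / real (Suc n)..<c}). R \<omega> x) \<in> borel_measurable M"
    "(\<lambda>\<omega>. INF x\<in>\<rat> \<inter> {0<..}. R \<omega> x) \<in> borel_measurable M" for n
    by (intro borel_measurable_INF; simp)+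
  show "{\<omega> \<in> space M. b \<omega> \<le> c} \<in> sets M"
  proof (rule complete_measure.in_sets_AE[OF complete])
    show "A \<in> sets M" unfolding A_def by measurable
    show "AE \<omega> in M. \<omega> \<in> A \<longleftrightarrow> \<omega> \<in> {\<omega> \<in> space M. b \<omega> \<le> c}"
      using min lsc right AE_space
    proof eventually_elim
      case (elim \<omega>)
      have iff: "b \<omega> \<in> {u..c} \<longleftrightarrow>
          (INF x\<in>insert c (\<rat> \<inter> {u..<c}). R \<omega> x) \<le> (INF x\<in>\<rat> \<inter> {0<..}. R \<omega> x)"
        if "0 < u" "u \<le> c" for u
        by (rule strict_minimiser_in_interval_iff[OF elim(1) _ _ that]) (use elim in blast)+
      have "0 < b \<omega>" using elim by (simp add: strict_min_at_def)
      then obtain n where n: "1 / real (Suc n) < b \<omega>"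
        using reals_Archimedean by (metis inverse_eq_divide)
      have "b \<omega> \<le> c \<longleftrightarrow> (\<exists>n. 1 / real (Suc n) \<le> c \<and> b \<omega> \<in> {1 / real (Suc n)..c})"
        using n by (auto intro!: exI[of _ n])
      also have "\<dots> \<longleftrightarrow> (\<exists>n. 1 / real (Suc n) \<le> c \<and>
          (INF x\<in>insert c (\<rat> \<inter> {1 / real (Suc n)..<c}). R \<omega> x) \<le> (INF x\<in>\<rat> \<inter> {0<..}. R \<omega> x))"
        using iff by (intro ex_cong1 conj_cong refl) auto
      finally show ?case using elim by (simp add: A_def)
    qed
  qed auto
qed

lemma borel_measurable_bayes_estimator:
  fixes b t :: "'a \<Rightarrow> real"
  assumes complete: "complete_measure M" and l: "l \<in> loss_class" and prior: "\<rho> \<in> prior_class"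
    and t[measurable]: "t \<in> borel_measurable M"
    and den: "AE \<omega> in M. set_integrable lborel {0<..} (post_weight I (t \<omega>) \<rho>) \<and>
          (LINT \<eta>:{0<..}|lborel. post_weight I (t \<omega>) \<rho> \<eta>) > 0"
    and min: "AE \<omega> in M. strict_min_at (posterior_risk l (post_density I (t \<omega>) \<rho>)) {0<..} (b \<omega>)"
  shows "b \<in> borel_measurable M"
proof (rule borel_measurable_strict_minimiser[OF complete _ min])
  have [measurable]: "\<rho> \<in> borel_measurable borel" and rho0: "\<And>x. 0 \<le> \<rho> x"
    using prior by (auto simp: prior_class_def)
  note [measurable] = loss_class_measurable[OF l]
  have pm[measurable]: "post_density I \<theta> \<rho> \<in> borel_measurable borel" for \<theta>
    unfolding post_density_def post_weight_def by measurable
  show "(\<lambda>\<omega>. posterior_risk l (post_density I (t \<omega>) \<rho>) x) \<in> borel_measurable M" for x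
    unfolding posterior_risk_def post_density_def post_weight_def set_lebesgue_integral_def by measurable
  have p0: "0 \<le> post_density I (t \<omega>) \<rho> x" if "(LINT \<eta>:{0<..}|lborel. post_weight I (t \<omega>) \<rho> \<eta>) > 0" for \<omega> x
    using that rho0 by (auto simp: post_density_def post_weight_def intro!: divide_nonneg_pos)
  show "AE \<omega> in M. \<forall>X x. X \<longlonglongrightarrow> x \<longrightarrow> posterior_risk l (post_density I (t \<omega>) \<rho>) x
          \<le> liminf (\<lambda>n. posterior_risk l (post_density I (t \<omega>) \<rho>) (X n))"
    using den by eventually_elim (use posterior_risk_lower_semicontinuous[OF l pm p0] in blast)
  show "AE \<omega> in M. \<forall>X x. 0 < x \<longrightarrow> posterior_risk l (post_density I (t \<omega>) \<rho>) x < \<infinity> \<longrightarrow> X \<longlonglongrightarrow> x \<longrightarrow>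
       (\<forall>n. x \<le> X n) \<longrightarrow> (\<lambda>n. posterior_risk l (post_density I (t \<omega>) \<rho>) (X n)) \<longlonglongrightarrow> posterior_risk l (post_density I (t \<omega>) \<rho>) x"
    using den
  proof eventually_elim
    case (elim \<omega>)
    let ?D = "LINT \<eta>:{0<..}|lborel. post_weight I (t \<omega>) \<rho> \<eta>"
    have "set_integrable lborel {0<..} (\<lambda>\<eta>. post_weight I (t \<omega>) \<rho> \<eta> / ?D)"
      using elim by (intro set_integrable_divide) auto
    then have "integrable lborel (\<lambda>\<eta>. indicator {0<..} \<eta> *\<^sub>R post_density I (t \<omega>) \<rho> \<eta>)"
      by (simp add: set_integrable_def post_density_def)
    then have "(\<integral>\<^sup>+\<eta>. ennreal (norm (indicator {0<..} \<eta> *\<^sub>R post_density I (t \<omega>) \<rho> \<eta>)) \<partial>lborel) < \<infinity>"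
      by (simp add: integrable_iff_bounded)
    also have "(\<integral>\<^sup>+\<eta>. ennreal (norm (indicator {0<..} \<eta> *\<^sub>R post_density I (t \<omega>) \<rho> \<eta>)) \<partial>lborel)
       = (\<integral>\<^sup>+\<eta>\<in>{0<..}. ennreal (post_density I (t \<omega>) \<rho> \<eta>) \<partial>lborel)"
      using p0 elim by (intro nn_integral_cong) (auto simp: indicator_def)
    finally show ?case
      using posterior_risk_right_continuous[OF l pm p0] elim by blast
  qed
qed

section \<open>The stochastic logarithm of a geometric Brownian motion\<close>

lemma stochastic_basis_prob_space: "stochastic_basis M F \<Longrightarrow> prob_space M"
  and stochastic_basis_complete: "stochastic_basis M F \<Longrightarrow> complete_measure M"
  by (auto simp: stochastic_basis_def)

lemma stochastic_basis_measurable: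
  assumes "stochastic_basis M F" and "X \<in> borel_measurable (F t)"
  shows "X \<in> borel_measurable M"
  using assms by (auto simp: stochastic_basis_def intro: measurable_from_subalg)

lemma stochastic_basis_measurable_mono:
  assumes basis: "stochastic_basis M F" and X: "X \<in> borel_measurable (F s)" and "s \<le> t"
  shows "X \<in> borel_measurable (F t)"
proof -
  interpret filtration "space M" F
    using basis by (simp add: stochastic_basis_def)
  have "subalgebra (F t) (F s)"
    using sets_F_mono[OF \<open>s \<le> t\<close>] by (auto simp: subalgebra_def space_F)
  then show ?thesis using X by (rule measurable_from_subalg)
qed

lemma brownian_motion_measurable:
  "brownian_motion M F w \<Longrightarrow> 0 \<le> t \<Longrightarrow> w t \<in> borel_measurable (F t)"
  by (simp add: brownian_motion_def)

lemma brownian_motion_increment: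
  "brownian_motion M F w \<Longrightarrow> 0 \<le> s \<Longrightarrow> s < t \<Longrightarrow>
     distributed M lborel (\<lambda>\<omega>. w t \<omega> - w s \<omega>) (normal_density 0 (sqrt (t - s)))"
  by (simp add: brownian_motion_def)

text \<open>The earlier increment is measurable with respect to the past at time \<open>s2\<close>.\<close>

lemma brownian_motion_increments_indep:
  assumes basis: "stochastic_basis M F" and bm: "brownian_motion M F w"
    and t: "0 \<le> s1" "s1 < t1" "t1 \<le> s2" "s2 < t2"
  shows "prob_space.indep_var M borel (\<lambda>\<omega>. w t1 \<omega> - w s1 \<omega>) borel (\<lambda>\<omega>. w t2 \<omega> - w s2 \<omega>)"
proof -
  interpret prob_space M using basis by (rule stochastic_basis_prob_space)
  have meas: "w t \<in> borel_measurable (F s)" if "0 \<le> t" "t \<le> s" for t s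
    by (rule stochastic_basis_measurable_mono[OF basis brownian_motion_measurable[OF bm that(1)] that(2)])
  have measM: "w t \<in> borel_measurable M" if "0 \<le> t" for t
    by (rule stochastic_basis_measurable[OF basis brownian_motion_measurable[OF bm that]])
  have X: "(\<lambda>\<omega>. w t1 \<omega> - w s1 \<omega>) \<in> borel_measurable (F s2)"
    using t by (intro borel_measurable_diff meas) auto
  have sp: "space (F s2) = space M"
    using basis by (auto simp: stochastic_basis_def subalgebra_def)
  have "indep_set (sets (F s2)) {(\<lambda>\<omega>. w t2 \<omega> - w s2 \<omega>) -` B \<inter> space M | B. B \<in> sets borel}"
    using bm t by (auto simp: brownian_motion_def)
  then have "indep_sets (case_bool (sets (F s2)) {(\<lambda>\<omega>. w t2 \<omega> - w s2 \<omega>) -` B \<inter> space M | B. B \<in> sets borel}) UNIV"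
    by (simp add: indep_set_def)
  then have "indep_sets (\<lambda>i. {case_bool (\<lambda>\<omega>. w t1 \<omega> - w s1 \<omega>) (\<lambda>\<omega>. w t2 \<omega> - w s2 \<omega>) i -` A \<inter> space M
      | A. A \<in> sets (case_bool borel borel i)}) UNIV"
  proof (rule indep_sets_mono_sets)
    fix i :: bool
    show "{case_bool (\<lambda>\<omega>. w t1 \<omega> - w s1 \<omega>) (\<lambda>\<omega>. w t2 \<omega> - w s2 \<omega>) i -` A \<inter> space M | A. A \<in> sets (case_bool borel borel i)}
      \<subseteq> case_bool (sets (F s2)) {(\<lambda>\<omega>. w t2 \<omega> - w s2 \<omega>) -` B \<inter> space M | B. B \<in> sets borel} i"
      using measurable_sets[OF X] by (cases i) (auto simp: sp)
  qed
  moreover have "random_variable (case_bool borel borel i) (case_bool (\<lambda>\<omega>. w t1 \<omega> - w s1 \<omega>) (\<lambda>\<omega>. w t2 \<omega> - w s2 \<omega>) i)" for i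
    using t by (cases i) (auto intro!: borel_measurable_diff measM)
  ultimately show ?thesis
    unfolding indep_var_def indep_vars_def2 by auto
qed

text \<open>Identifies a stochastic integral, which is given as a limit in probability, with an explicit limit.\<close>

lemma conv_in_prob_unique:
  assumes M: "prob_space M" and [measurable]: "\<And>n. X n \<in> borel_measurable M"
    "Y \<in> borel_measurable M" "Z \<in> borel_measurable M"
    and Y: "conv_in_prob M X Y" and Z: "conv_in_prob M X Z"
  shows "AE \<omega> in M. Y \<omega> = Z \<omega>"
proof -
  interpret prob_space M by fact
  have zero: "prob {\<omega>\<in>space M. \<bar>Y \<omega> - Z \<omega>\<bar> > e} = 0" if "e > 0" for e
  proof -
    have "(\<lambda>n. prob {\<omega>\<in>space M. \<bar>X n \<omega> - Y \<omega>\<bar> > e / 2} + prob {\<omega>\<in>space M. \<bar>X n \<omega> - Z \<omega>\<bar> > e / 2}) \<longlonglongrightarrow> 0 + 0"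
      using Y[unfolded conv_in_prob_def, rule_format, of "e / 2"] Z[unfolded conv_in_prob_def, rule_format, of "e / 2"] that
      by (intro tendsto_add) simp_all
    moreover have "prob {\<omega>\<in>space M. \<bar>Y \<omega> - Z \<omega>\<bar> > e}
        \<le> prob {\<omega>\<in>space M. \<bar>X n \<omega> - Y \<omega>\<bar> > e / 2} + prob {\<omega>\<in>space M. \<bar>X n \<omega> - Z \<omega>\<bar> > e / 2}" for n
    proof -
      have "prob {\<omega>\<in>space M. \<bar>Y \<omega> - Z \<omega>\<bar> > e}
        \<le> prob ({\<omega>\<in>space M. \<bar>X n \<omega> - Y \<omega>\<bar> > e / 2} \<union> {\<omega>\<in>space M. \<bar>X n \<omega> - Z \<omega>\<bar> > e / 2})"
      proof (intro finite_measure_mono subsetI)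
        fix \<omega> assume "\<omega> \<in> {\<omega>\<in>space M. \<bar>Y \<omega> - Z \<omega>\<bar> > e}"
        moreover from this have "\<bar>X n \<omega> - Y \<omega>\<bar> > e / 2 \<or> \<bar>X n \<omega> - Z \<omega>\<bar> > e / 2"
          unfolding mem_Collect_eq by linarith
        ultimately show "\<omega> \<in> {\<omega>\<in>space M. \<bar>X n \<omega> - Y \<omega>\<bar> > e / 2} \<union> {\<omega>\<in>space M. \<bar>X n \<omega> - Z \<omega>\<bar> > e / 2}"
          by blast
      qed measurable
      also have "\<dots> \<le> prob {\<omega>\<in>space M. \<bar>X n \<omega> - Y \<omega>\<bar> > e / 2} + prob {\<omega>\<in>space M. \<bar>X n \<omega> - Z \<omega>\<bar> > e / 2}"
        by (intro measure_subadditive) (auto simp: emeasure_eq_measure)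
      finally show ?thesis .
    qed
    ultimately have "prob {\<omega>\<in>space M. \<bar>Y \<omega> - Z \<omega>\<bar> > e} \<le> 0 + 0"
      by (intro LIMSEQ_le_const[of _ "0 + 0"]) auto
    then show ?thesis by (simp add: measure_le_0_iff)
  qed
  have "AE \<omega> in M. \<forall>n. \<not> \<bar>Y \<omega> - Z \<omega>\<bar> > 1 / real (Suc n)"
  proof (subst AE_all_countable, intro allI)
    fix n
    have "emeasure M {\<omega>\<in>space M. \<bar>Y \<omega> - Z \<omega>\<bar> > 1 / real (Suc n)} = 0"
      using zero[of "1 / real (Suc n)"] by (simp add: emeasure_eq_measure)
    then show "AE \<omega> in M. \<not> \<bar>Y \<omega> - Z \<omega>\<bar> > 1 / real (Suc n)"
      by (intro AE_I[of _ _ "{\<omega>\<in>space M. \<bar>Y \<omega> - Z \<omega>\<bar> > 1 / real (Suc n)}"]) auto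
  qed
  then show ?thesis
  proof eventually_elim
    case (elim \<omega>)
    show ?case
    proof (rule ccontr)
      assume "Y \<omega> \<noteq> Z \<omega>"
      then have "\<bar>Y \<omega> - Z \<omega>\<bar> > 0" by simp
      then obtain n where "1 / real (Suc n) < \<bar>Y \<omega> - Z \<omega>\<bar>"
        using reals_Archimedean by (metis inverse_eq_divide)
      then show False using elim by blast
    qed
  qed
qed

text \<open>Completing the square: exponential moments of a Gaussian are moments of a shifted Gaussian.\<close>

lemma normal_density_exp_tilt:
  assumes "\<sigma> > 0"
  shows "normal_density 0 \<sigma> x * exp (a * x) = exp (a\<^sup>2 * \<sigma>\<^sup>2 / 2) * normal_density (a * \<sigma>\<^sup>2) \<sigma> x"
proof -
  have "- (x - 0)\<^sup>2 / (2 * \<sigma>\<^sup>2) + a * x = a\<^sup>2 * \<sigma>\<^sup>2 / 2 + - (x - a * \<sigma>\<^sup>2)\<^sup>2 / (2 * \<sigma>\<^sup>2)"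
    using assms by (simp add: field_simps power2_eq_square)
  then have "exp (- (x - 0)\<^sup>2 / (2 * \<sigma>\<^sup>2)) * exp (a * x) = exp (a\<^sup>2 * \<sigma>\<^sup>2 / 2) * exp (- (x - a * \<sigma>\<^sup>2)\<^sup>2 / (2 * \<sigma>\<^sup>2))"
    unfolding exp_add[symmetric] by simp
  then show ?thesis
    unfolding normal_density_def by simp
qed

text \<open>The factor by which a geometric Brownian motion \<open>X\<close> with drift \<open>-c\<close> and volatility \<open>v\<close> grows in time
\<open>h\<close>, when the driving increment is \<open>x\<close>, is \<open>exp (v * x - (c + v\<^sup>2 / 2) * h)\<close>. The relative increment of \<open>X\<close> is
this factor minus one; subtracting its infinitesimal form \<open>v * x - c * h\<close> leaves the remainder.\<close>

definition ito_remainder :: "real \<Rightarrow> real \<Rightarrow> real \<Rightarrow> real \<Rightarrow> real" where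
  "ito_remainder c v h x = exp (v * x - (c + v\<^sup>2 / 2) * h) - 1 + c * h - v * x"

text \<open>Expanding the square leaves Gaussian integrals of \<open>1\<close>, \<open>x\<close>, \<open>x\<^sup>2\<close>, \<open>exp (a * x)\<close> and
\<open>x * exp (a * x)\<close>. The first moment and the second moment are both of order \<open>h\<^sup>2\<close>, since all
terms of lower order cancel; the correction \<open>v\<^sup>2 / 2\<close> in the exponent is what makes this work.\<close>

lemma ito_remainder_moments:
  assumes h: "h > 0"
  shows "has_bochner_integral lborel (\<lambda>x. normal_density 0 (sqrt h) x * ito_remainder c v h x)
           (exp (- c * h) - 1 + c * h)" (is ?m1)
    and "has_bochner_integral lborel (\<lambda>x. normal_density 0 (sqrt h) x * (ito_remainder c v h x)\<^sup>2)
           (exp (v\<^sup>2 * h - 2 * c * h) + (1 - c * h)\<^sup>2 + v\<^sup>2 * h - 2 * (1 - c * h) * exp (- c * h)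
              - 2 * v\<^sup>2 * h * exp (- c * h))" (is ?m2)
proof -
  let ?d = "normal_density 0 (sqrt h)"
  define k where "k = (c + v\<^sup>2 / 2) * h"
  have sh: "sqrt h > 0" "(sqrt h)\<^sup>2 = h" using h by auto
  have one: "has_bochner_integral lborel ?d 1"
    using sh by (simp add: has_bochner_integral_iff)
  have x1: "has_bochner_integral lborel (\<lambda>x. ?d x * x) 0"
    using normal_moment_nz_1[OF sh(1), of 0] by simp
  have x2: "has_bochner_integral lborel (\<lambda>x. ?d x * x\<^sup>2) h"
    using normal_moment_even[OF sh(1), of 0 1] h by (simp add: fact_numeral)
  have e: "has_bochner_integral lborel (\<lambda>x. ?d x * exp (a * x)) (exp (a\<^sup>2 * h / 2))" for a
  proof -
    have "has_bochner_integral lborel (\<lambda>x. exp (a\<^sup>2 * h / 2) * normal_density (a * h) (sqrt h) x) (exp (a\<^sup>2 * h / 2) * 1)"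
      using sh by (intro has_bochner_integral_mult_right) (auto simp: has_bochner_integral_iff)
    then show ?thesis
      using normal_density_exp_tilt[OF sh(1)] by (simp add: sh)
  qed
  have ex: "has_bochner_integral lborel (\<lambda>x. ?d x * exp (a * x) * x) (exp (a\<^sup>2 * h / 2) * (a * h))" for a
  proof -
    have "has_bochner_integral lborel (\<lambda>x. exp (a\<^sup>2 * h / 2) * (normal_density (a * h) (sqrt h) x * x)) (exp (a\<^sup>2 * h / 2) * (a * h))"
      using normal_moment_nz_1[OF sh(1), of "a * h"] by (intro has_bochner_integral_mult_right)
    then show ?thesis
      using normal_density_exp_tilt[OF sh(1)] by (simp add: sh mult.assoc)
  qed
  have exp_split: "exp (v * x - k) = exp (- k) * exp (v * x)" for x
    by (simp add: exp_diff exp_minus divide_inverse mult.commute)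
  have trans: "has_bochner_integral lborel g y" if "has_bochner_integral lborel f z" "\<And>x. f x = g x" "z = y" for f g :: "real \<Rightarrow> real" and y z
    using that by (metis ext)
  have k: "exp (- k) * exp (v\<^sup>2 * h / 2) = exp (- c * h)" "(exp (- k))\<^sup>2 * exp ((2 * v)\<^sup>2 * h / 2) = exp (v\<^sup>2 * h - 2 * c * h)"
    by (simp_all add: k_def exp_double[symmetric] exp_add[symmetric] algebra_simps)
  have "has_bochner_integral lborel (\<lambda>x. exp (- k) * (?d x * exp (v * x)) + (- (1 - c * h)) * ?d x + (- v) * (?d x * x))
     (exp (- k) * exp (v\<^sup>2 * h / 2) + (- (1 - c * h)) * 1 + (- v) * 0)"
    by (intro has_bochner_integral_add has_bochner_integral_mult_right e one x1)
  then show ?m1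
  proof (rule trans)
    show "exp (- k) * (?d x * exp (v * x)) + (- (1 - c * h)) * ?d x + (- v) * (?d x * x) = ?d x * ito_remainder c v h x" for x
      unfolding ito_remainder_def k_def[symmetric] exp_split by (simp add: algebra_simps)
  qed (simp only: k, simp)
  have "has_bochner_integral lborel (\<lambda>x. (exp (- k))\<^sup>2 * (?d x * exp (2 * v * x)) + (1 - c * h)\<^sup>2 * ?d x + v\<^sup>2 * (?d x * x\<^sup>2)
        + (- 2 * (1 - c * h) * exp (- k)) * (?d x * exp (v * x)) + (- 2 * v * exp (- k)) * (?d x * exp (v * x) * x)
        + (2 * v * (1 - c * h)) * (?d x * x))
     ((exp (- k))\<^sup>2 * exp ((2 * v)\<^sup>2 * h / 2) + (1 - c * h)\<^sup>2 * 1 + v\<^sup>2 * h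
        + (- 2 * (1 - c * h) * exp (- k)) * exp (v\<^sup>2 * h / 2) + (- 2 * v * exp (- k)) * (exp (v\<^sup>2 * h / 2) * (v * h))
        + (2 * v * (1 - c * h)) * 0)"
    by (intro has_bochner_integral_add has_bochner_integral_mult_right e ex one x1 x2)
  then show ?m2
  proof (rule trans)
    show "(exp (- k))\<^sup>2 * (?d x * exp (2 * v * x)) + (1 - c * h)\<^sup>2 * ?d x + v\<^sup>2 * (?d x * x\<^sup>2)
        + (- 2 * (1 - c * h) * exp (- k)) * (?d x * exp (v * x)) + (- 2 * v * exp (- k)) * (?d x * exp (v * x) * x)
        + (2 * v * (1 - c * h)) * (?d x * x) = ?d x * (ito_remainder c v h x)\<^sup>2" for x
    proof -
      have "exp (2 * v * x) = (exp (v * x))\<^sup>2"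
        by (simp add: exp_double[symmetric] mult.assoc)
      then show ?thesis
        unfolding ito_remainder_def k_def[symmetric] exp_split by (simp add: algebra_simps power2_eq_square)
    qed
    have regroup: "(- 2 * (1 - c * h) * exp (- k)) * exp (v\<^sup>2 * h / 2) = - 2 * (1 - c * h) * (exp (- k) * exp (v\<^sup>2 * h / 2))"
      "(- 2 * v * exp (- k)) * (exp (v\<^sup>2 * h / 2) * (v * h)) = - 2 * v\<^sup>2 * h * (exp (- k) * exp (v\<^sup>2 * h / 2))"
      by (simp_all add: power2_eq_square)
    show "(exp (- k))\<^sup>2 * exp ((2 * v)\<^sup>2 * h / 2) + (1 - c * h)\<^sup>2 * 1 + v\<^sup>2 * h
        + (- 2 * (1 - c * h) * exp (- k)) * exp (v\<^sup>2 * h / 2) + (- 2 * v * exp (- k)) * (exp (v\<^sup>2 * h / 2) * (v * h))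
        + (2 * v * (1 - c * h)) * 0 = exp (v\<^sup>2 * h - 2 * c * h) + (1 - c * h)\<^sup>2 + v\<^sup>2 * h - 2 * (1 - c * h) * exp (- c * h)
              - 2 * v\<^sup>2 * h * exp (- c * h)"
      unfolding regroup k by (simp add: algebra_simps)
  qed
qed

lemma ito_remainder_moments_limit:
  fixes c v T :: real
  assumes "T > 0" "v > 0" "c > 0"
  shows "(\<lambda>n. real n * (exp (v\<^sup>2 * (T / real n) - 2 * c * (T / real n)) + (1 - c * (T / real n))\<^sup>2 + v\<^sup>2 * (T / real n)
              - 2 * (1 - c * (T / real n)) * exp (- c * (T / real n)) - 2 * v\<^sup>2 * (T / real n) * exp (- c * (T / real n)))) \<longlonglongrightarrow> 0"
    and "(\<lambda>n. real n * (exp (- c * (T / real n)) - 1 + c * (T / real n))) \<longlonglongrightarrow> 0"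
  using assms by real_asymp+

definition equidistant :: "real \<Rightarrow> nat \<Rightarrow> nat \<Rightarrow> real" where
  "equidistant T n i = T * real i / real n"

lemma equidistant_step: "n > 0 \<Longrightarrow> equidistant T n (Suc i) - equidistant T n i = T / real n"
  by (simp add: equidistant_def diff_divide_distrib[symmetric] algebra_simps)

text \<open>Expand the square into a double sum. The diagonal contributes \<open>n\<close> second moments. Off the diagonal
the two remainders belong to disjoint steps and are independent, so their product has expectation
\<open>m1\<^sup>2\<close>.\<close>

lemma brownian_ito_remainder_sum:
  fixes c v :: real
  assumes basis: "stochastic_basis M F" and bm: "brownian_motion M F w"
    and T: "T > 0" and n: "n > 0"
  defines "h \<equiv> T / real n"
  defines "D \<equiv> \<lambda>i \<omega>. w (equidistant T n (Suc i)) \<omega> - w (equidistant T n i) \<omega>"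
  defines "m1 \<equiv> exp (- c * h) - 1 + c * h"
  defines "m2 \<equiv> exp (v\<^sup>2 * h - 2 * c * h) + (1 - c * h)\<^sup>2 + v\<^sup>2 * h - 2 * (1 - c * h) * exp (- c * h)
              - 2 * v\<^sup>2 * h * exp (- c * h)"
  shows "integrable M (\<lambda>\<omega>. (\<Sum>i<n. ito_remainder c v h (D i \<omega>))\<^sup>2)"
    and "(\<integral>\<omega>. (\<Sum>i<n. ito_remainder c v h (D i \<omega>))\<^sup>2 \<partial>M) \<le> real n * m2 + (real n * m1)\<^sup>2"
proof -
  interpret prob_space M using basis by (rule stochastic_basis_prob_space)
  let ?R = "ito_remainder c v h"
  have [measurable]: "?R \<in> borel_measurable borel"
    unfolding ito_remainder_def by measurable
  have h: "h > 0" using T n by (simp add: h_def)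
  have step: "equidistant T n (Suc i) - equidistant T n i = h" for i
    using n by (simp add: equidistant_step h_def)
  have mono: "equidistant T n i \<le> equidistant T n j" if "i \<le> j" for i j
    using that T by (simp add: equidistant_def divide_right_mono)
  have nonneg: "0 \<le> equidistant T n i" for i
    using T by (simp add: equidistant_def)
  have dist: "distributed M lborel (D i) (normal_density 0 (sqrt h))" for i
    using brownian_motion_increment[OF bm nonneg, of i "equidistant T n (Suc i)"] step[of i] h
    by (simp add: D_def)
  have one: "integrable M (\<lambda>\<omega>. ?R (D i \<omega>))" "(\<integral>\<omega>. ?R (D i \<omega>) \<partial>M) = m1" for i
    using ito_remainder_moments(1)[OF h, of c v]
      distributed_integrable[OF dist[of i], of ?R] distributed_integral[OF dist[of i], of ?R]
    by (auto simp: has_bochner_integral_iff m1_def)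
  have two: "integrable M (\<lambda>\<omega>. (?R (D i \<omega>))\<^sup>2)" "(\<integral>\<omega>. (?R (D i \<omega>))\<^sup>2 \<partial>M) = m2" for i
    using ito_remainder_moments(2)[OF h, of c v]
      distributed_integrable[OF dist[of i], of "\<lambda>x. (?R x)\<^sup>2"] distributed_integral[OF dist[of i], of "\<lambda>x. (?R x)\<^sup>2"]
    by (auto simp: has_bochner_integral_iff m2_def)
  have cross_less: "integrable M (\<lambda>\<omega>. ?R (D i \<omega>) * ?R (D j \<omega>)) \<and> (\<integral>\<omega>. ?R (D i \<omega>) * ?R (D j \<omega>) \<partial>M) = m1\<^sup>2"
    if "i < j" for i j
  proof -
    have "indep_var borel (D i) borel (D j)"
      unfolding D_def
    proof (rule brownian_motion_increments_indep[OF basis bm nonneg])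
      show "equidistant T n i < equidistant T n (Suc i)" "equidistant T n j < equidistant T n (Suc j)"
        using step[of i] step[of j] h by linarith+
      show "equidistant T n (Suc i) \<le> equidistant T n j"
        using that by (intro mono) simp
    qed
    then have "indep_var borel (?R \<circ> D i) borel (?R \<circ> D j)"
      by (rule indep_var_compose) measurable
    then have "indep_var borel (\<lambda>\<omega>. ?R (D i \<omega>)) borel (\<lambda>\<omega>. ?R (D j \<omega>))"
      by (simp add: o_def)
    then show ?thesis
      using indep_var_lebesgue_integral[OF _ one(1)[of i] one(1)[of j]] indep_var_integrable[OF _ one(1)[of i] one(1)[of j]]
      by (simp add: one power2_eq_square)
  qed
  have cross: "integrable M (\<lambda>\<omega>. ?R (D i \<omega>) * ?R (D j \<omega>))"
    "(\<integral>\<omega>. ?R (D i \<omega>) * ?R (D j \<omega>) \<partial>M) = (if i = j then m2 else m1\<^sup>2)" for i j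
    using cross_less[of i j] cross_less[of j i] two[of i]
    by (cases i j rule: linorder_cases; simp add: power2_eq_square mult.commute)+
  have sq: "(\<Sum>i<n. ?R (D i \<omega>))\<^sup>2 = (\<Sum>i<n. \<Sum>j<n. ?R (D i \<omega>) * ?R (D j \<omega>))" for \<omega>
    by (simp add: power2_eq_square sum_product)
  show "integrable M (\<lambda>\<omega>. (\<Sum>i<n. ?R (D i \<omega>))\<^sup>2)"
    unfolding sq by (intro Bochner_Integration.integrable_sum cross)
  have "(\<integral>\<omega>. (\<Sum>i<n. ?R (D i \<omega>))\<^sup>2 \<partial>M) = (\<Sum>i<n. \<Sum>j<n. if i = j then m2 else m1\<^sup>2)"
    unfolding sq by (simp add: Bochner_Integration.integral_sum cross)
  also have "\<dots> \<le> (\<Sum>i<n. \<Sum>j<n. (if i = j then m2 else 0) + m1\<^sup>2)"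
    by (intro sum_mono) auto
  also have "\<dots> = real n * m2 + (real n * m1)\<^sup>2"
    by (simp add: sum.distrib power2_eq_square algebra_simps)
  finally show "(\<integral>\<omega>. (\<Sum>i<n. ?R (D i \<omega>))\<^sup>2 \<partial>M) \<le> real n * m2 + (real n * m1)\<^sup>2" .
qed


lemma simple_path_eq:
  assumes mono: "\<And>i j. i \<le> j \<Longrightarrow> \<tau> i \<le> \<tau> j" and i: "i < m" and t: "\<tau> i < t" "t \<le> \<tau> (Suc i)"
  shows "simple_path m \<tau> \<xi> t \<omega> = \<xi> i \<omega>"
proof -
  have ind: "indicator {\<tau> j<..\<tau> (Suc j)} t = (if j = i then 1 else 0 :: real)" for j
    using t mono[of "Suc j" i] mono[of "Suc i" j] by (cases i j rule: linorder_cases) (auto simp: indicator_def)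
  then show ?thesis
    using i unfolding simple_path_def ind by (simp add: if_distrib[where f="\<lambda>x. _ * x"] cong: if_cong)
qed

text \<open>Left-point sampling of a continuous path approximates it uniformly on \<open>(0, T]\<close>, so it is an
admissible approximation in the definition of the stochastic integral.\<close>

lemma left_point_sampling_uniform_limit:
  assumes T: "T > 0" and cont: "continuous_on {0..T} (\<lambda>t. H t \<omega>)"
  shows "uniform_limit {0<..T}
    (\<lambda>n t. simple_path (Suc n) (equidistant T (Suc n)) (\<lambda>i \<omega>. H (equidistant T (Suc n) i) \<omega>) t \<omega>) (\<lambda>t. H t \<omega>) sequentially"
proof (rule uniform_limitI)
  fix e :: real assume "e > 0"
  have "uniformly_continuous_on {0..T} (\<lambda>t. H t \<omega>)"
    using cont by (rule compact_uniformly_continuous) simp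
  then obtain d where d: "d > 0"
    "\<And>s t. s \<in> {0..T} \<Longrightarrow> t \<in> {0..T} \<Longrightarrow> dist s t < d \<Longrightarrow> dist (H s \<omega>) (H t \<omega>) < e"
    using \<open>e > 0\<close> unfolding uniformly_continuous_on_def by metis
  have "(\<lambda>n. T * (1 / real (Suc n))) \<longlonglongrightarrow> T * 0"
    by (intro tendsto_mult tendsto_const LIMSEQ_Suc[OF lim_1_over_n])
  then have "\<forall>\<^sub>F n in sequentially. T / real (Suc n) < d"
    using order_tendstoD(2)[of "\<lambda>n. T * (1 / real (Suc n))" 0] d(1) by simp
  then show "\<forall>\<^sub>F n in sequentially. \<forall>t\<in>{0<..T}.
     dist (simple_path (Suc n) (equidistant T (Suc n)) (\<lambda>i \<omega>. H (equidistant T (Suc n) i) \<omega>) t \<omega>) (H t \<omega>) < e"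
  proof eventually_elim
    case (elim n)
    show ?case
    proof
      fix t assume t: "t \<in> {0<..T}"
      define y where "y = t * real (Suc n) / T"
      define i where "i = nat \<lceil>y\<rceil> - 1"
      have y: "0 < y" "y \<le> real (Suc n)"
        using t T by (auto simp: y_def pos_divide_le_eq mult.commute intro: mult_right_mono)
      then have i: "real i < y" "y \<le> real (Suc i)" "i < Suc n"
        unfolding i_def by linarith+
      have t_eq: "t = T * y / real (Suc n)"
        using T by (simp add: y_def)
      have ti: "equidistant T (Suc n) i < t" "t \<le> equidistant T (Suc n) (Suc i)"
        unfolding t_eq equidistant_def using i T by (auto intro!: divide_strict_right_mono divide_right_mono)
      have "equidistant T (Suc n) (Suc i) - equidistant T (Suc n) i = T / real (Suc n)"
        by (simp add: equidistant_step)
      then have "dist (equidistant T (Suc n) i) t < d"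
        using ti elim by (simp add: dist_real_def)
      moreover have "0 \<le> equidistant T (Suc n) i"
        using T by (simp add: equidistant_def)
      ultimately have "dist (H (equidistant T (Suc n) i) \<omega>) (H t \<omega>) < e"
        using t ti by (intro d(2)) auto
      moreover have "equidistant T (Suc n) i \<le> equidistant T (Suc n) j" if "i \<le> j" for i j
        using that T by (auto simp: equidistant_def intro!: divide_right_mono)
      ultimately show "dist (simple_path (Suc n) (equidistant T (Suc n)) (\<lambda>i \<omega>. H (equidistant T (Suc n) i) \<omega>) t \<omega>) (H t \<omega>) < e"
        using simple_path_eq[of "equidistant T (Suc n)" i "Suc n" t "\<lambda>i \<omega>. H (equidistant T (Suc n) i) \<omega>" \<omega>, OF _ i(3) ti] by simp
    qed
  qed
qed

text \<open>The left-point sum of \<open>1 / X\<close> against \<open>X\<close> is the sum of the relative increments of \<open>X\<close>. Each is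
the remainder plus \<open>v * x - c * h\<close>, and the latter telescopes to the claimed value. The sum of the remainders
vanishes in mean square: over \<open>n\<close> steps of length \<open>T / n\<close> it contributes \<open>n\<close> second moments and the
square of \<open>n\<close> first moments, each moment being of order \<open>1 / n\<^sup>2\<close>.\<close>

lemma stochastic_log_of_geometric_bm:
  fixes c v T :: real
  assumes basis: "stochastic_basis M F" and bm: "brownian_motion M F w"
    and T: "T > 0" and c: "c > 0" and v: "v > 0"
    and x0: "x0 \<in> borel_measurable (F 0)" "AE \<omega> in M. x0 \<omega> \<noteq> 0"
    and X: "\<And>t \<omega>. X t \<omega> = x0 \<omega> * exp (- (c + v\<^sup>2 / 2) * t + v * w t \<omega>)"
    and J: "is_stochastic_integral M F T (\<lambda>t \<omega>. 1 / X t \<omega>) X J"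
  shows "AE \<omega> in M. J \<omega> = - c * T + v * (w T \<omega> - w 0 \<omega>)"
proof -
  interpret prob_space M using basis by (rule stochastic_basis_prob_space)
  have measF: "w t \<in> borel_measurable (F t)" if "0 \<le> t" for t
    by (rule brownian_motion_measurable[OF bm that])
  have measM: "w t \<in> borel_measurable M" if "0 \<le> t" for t
    by (rule stochastic_basis_measurable[OF basis measF[OF that]])
  have x0M: "x0 \<in> borel_measurable M"
    by (rule stochastic_basis_measurable[OF basis x0(1)])
  have XM: "X t \<in> borel_measurable M" if "0 \<le> t" for t
    using measM[OF that] x0M unfolding X[abs_def] by measurable
  have XF: "(\<lambda>\<omega>. 1 / X t \<omega>) \<in> borel_measurable (F t)" if "0 \<le> t" for t
    using measF[OF that] stochastic_basis_measurable_mono[OF basis x0(1) that] unfolding X[abs_def] by measurable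
  define \<tau> where "\<tau> n = equidistant T (Suc n)" for n
  define \<xi> where "\<xi> n i \<omega> = 1 / X (\<tau> n i) \<omega>" for n i \<omega>
  define R where "R n \<omega> = (\<Sum>i<Suc n. ito_remainder c v (T / real (Suc n)) (w (\<tau> n (Suc i)) \<omega> - w (\<tau> n i) \<omega>))" for n \<omega>
  define L where "L \<omega> = - c * T + v * (w T \<omega> - w 0 \<omega>)" for \<omega>
  have tau: "0 \<le> \<tau> n i" "\<tau> n i \<le> \<tau> n (Suc i)" "\<tau> n 0 = 0" "\<tau> n (Suc n) = T" "\<tau> n (Suc i) - \<tau> n i = T / real (Suc n)" for n i
    using T by (auto simp: \<tau>_def equidistant_step) (auto simp: equidistant_def intro!: divide_right_mono)
  have w_cont: "AE \<omega> in M. continuous_on {0..} (\<lambda>t. w t \<omega>)"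
    using bm by (auto simp: brownian_motion_def)
  have SM: "simple_integral (Suc n) (\<tau> n) (\<xi> n) X \<in> borel_measurable M" for n
    unfolding simple_integral_def[abs_def] \<xi>_def
    by (intro borel_measurable_sum borel_measurable_times borel_measurable_divide borel_measurable_diff XM tau) auto
  have SJ: "conv_in_prob M (\<lambda>n. simple_integral (Suc n) (\<tau> n) (\<xi> n) X) J"
  proof -
    have "simple_integrand F T (Suc n) (\<tau> n) (\<xi> n)" for n
      using tau XF by (auto simp: simple_integrand_def \<xi>_def[abs_def])
    moreover have "AE \<omega> in M. uniform_limit {0<..T} (\<lambda>n t. simple_path (Suc n) (\<tau> n) (\<xi> n) t \<omega>)
                        (\<lambda>t. 1 / X t \<omega>) sequentially"
      using w_cont x0(2)
    proof eventually_elim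
      case (elim \<omega>)
      have "continuous_on {0..T} (\<lambda>t. w t \<omega>)"
        using elim(1) by (rule continuous_on_subset) auto
      then have "continuous_on {0..T} (\<lambda>t. 1 / X t \<omega>)"
        unfolding X using elim(2) by (intro continuous_intros) auto
      from left_point_sampling_uniform_limit[where H="\<lambda>t \<omega>. 1 / X t \<omega>", OF T this] show ?case
        by (simp add: \<tau>_def \<xi>_def[abs_def])
    qed
    ultimately show ?thesis
      using J unfolding is_stochastic_integral_def by blast
  qed
  have S_eq: "AE \<omega> in M. simple_integral (Suc n) (\<tau> n) (\<xi> n) X \<omega> = R n \<omega> + L \<omega>" for n
    using x0(2)
  proof eventually_elim
    case (elim \<omega>)
    let ?h = "T / real (Suc n)"
    have step: "\<xi> n i \<omega> * (X (\<tau> n (Suc i)) \<omega> - X (\<tau> n i) \<omega>)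
        = ito_remainder c v ?h (w (\<tau> n (Suc i)) \<omega> - w (\<tau> n i) \<omega>) - c * ?h + v * (w (\<tau> n (Suc i)) \<omega> - w (\<tau> n i) \<omega>)" for i
    proof -
      have "\<xi> n i \<omega> * (X (\<tau> n (Suc i)) \<omega> - X (\<tau> n i) \<omega>)
          = exp (- (c + v\<^sup>2 / 2) * \<tau> n (Suc i) + v * w (\<tau> n (Suc i)) \<omega>) / exp (- (c + v\<^sup>2 / 2) * \<tau> n i + v * w (\<tau> n i) \<omega>) - 1"
        using elim by (simp add: \<xi>_def X field_simps)
      also have "\<dots> = exp (v * (w (\<tau> n (Suc i)) \<omega> - w (\<tau> n i) \<omega>) - (c + v\<^sup>2 / 2) * (\<tau> n (Suc i) - \<tau> n i)) - 1"
      proof -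
        have "exp (- K * s' + x') / exp (- K * s + x) = exp ((x' - x) - K * (s' - s))" for K s s' x x' :: real
          by (simp add: exp_diff[symmetric] algebra_simps)
        then show ?thesis by (simp only: right_diff_distrib)
      qed
      finally show ?thesis
        unfolding tau by (simp add: ito_remainder_def)
    qed
    have "simple_integral (Suc n) (\<tau> n) (\<xi> n) X \<omega>
        = R n \<omega> - (\<Sum>i<Suc n. c * ?h) + v * (\<Sum>i<Suc n. w (\<tau> n (Suc i)) \<omega> - w (\<tau> n i) \<omega>)"
      unfolding simple_integral_def step R_def sum_distrib_left sum_subtractf[symmetric] sum.distrib[symmetric] ..
    also have "(\<Sum>i<Suc n. w (\<tau> n (Suc i)) \<omega> - w (\<tau> n i) \<omega>) = w T \<omega> - w 0 \<omega>"
      by (subst sum_lessThan_telescope) (simp add: tau)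
    also have "(\<Sum>i<Suc n. c * ?h) = c * T"
      by (simp del: of_nat_Suc)
    finally show ?case
      by (simp add: L_def)
  qed
  have SL: "conv_in_prob M (\<lambda>n. simple_integral (Suc n) (\<tau> n) (\<xi> n) X) L"
    unfolding conv_in_prob_def
  proof (intro allI impI)
    fix e :: real assume e: "e > 0"
    have RM[measurable]: "R n \<in> borel_measurable M" for n
      unfolding R_def[abs_def] ito_remainder_def using measM[OF tau(1)] by measurable
    define b where "b n = (let h = T / real n in
        real n * (exp (v\<^sup>2 * h - 2 * c * h) + (1 - c * h)\<^sup>2 + v\<^sup>2 * h - 2 * (1 - c * h) * exp (- c * h)
              - 2 * v\<^sup>2 * h * exp (- c * h)) + (real n * (exp (- c * h) - 1 + c * h))\<^sup>2)" for n
    have b_lim: "b \<longlonglongrightarrow> 0"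
      unfolding b_def Let_def
      using tendsto_add[OF ito_remainder_moments_limit(1)[OF T v c] tendsto_power[OF ito_remainder_moments_limit(2)[OF T v c], of 2]]
      by simp
    show "(\<lambda>n. prob {\<omega>\<in>space M. \<bar>simple_integral (Suc n) (\<tau> n) (\<xi> n) X \<omega> - L \<omega>\<bar> > e}) \<longlonglongrightarrow> 0"
    proof (rule tendsto_sandwich[OF always_eventually always_eventually tendsto_const])
      show "\<forall>n. prob {\<omega>\<in>space M. \<bar>simple_integral (Suc n) (\<tau> n) (\<xi> n) X \<omega> - L \<omega>\<bar> > e} \<le> b (Suc n) / e\<^sup>2"
      proof
        fix n
        have mom: "integrable M (\<lambda>\<omega>. (R n \<omega>)\<^sup>2)" "(\<integral>\<omega>. (R n \<omega>)\<^sup>2 \<partial>M) \<le> b (Suc n)"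
          unfolding R_def \<tau>_def b_def Let_def
          by (rule brownian_ito_remainder_sum[OF basis bm T zero_less_Suc])+
        have "prob {\<omega>\<in>space M. \<bar>simple_integral (Suc n) (\<tau> n) (\<xi> n) X \<omega> - L \<omega>\<bar> > e}
            \<le> prob {\<omega>\<in>space M. \<bar>R n \<omega>\<bar> \<ge> e}"
          using S_eq[of n] by (intro finite_measure_mono_AE) (auto elim!: eventually_mono)
        also have "\<dots> \<le> (\<integral>\<omega>. (R n \<omega>)\<^sup>2 \<partial>M) / e\<^sup>2"
          using mom(1) e by (intro second_moment_method RM) auto
        also have "\<dots> \<le> b (Suc n) / e\<^sup>2"
          using mom(2) by (intro divide_right_mono) simp_all
        finally show "prob {\<omega>\<in>space M. \<bar>simple_integral (Suc n) (\<tau> n) (\<xi> n) X \<omega> - L \<omega>\<bar> > e} \<le> b (Suc n) / e\<^sup>2" .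
      qed
      show "(\<lambda>n. b (Suc n) / e\<^sup>2) \<longlonglongrightarrow> 0"
        using tendsto_divide[OF LIMSEQ_Suc[OF b_lim] tendsto_const, of "e\<^sup>2"] e by simp
    qed auto
  qed
  have [measurable]: "w T \<in> borel_measurable M" "w 0 \<in> borel_measurable M"
    using T by (auto intro: measM)
  have "L \<in> borel_measurable M"
    unfolding L_def[abs_def] by measurable
  moreover have "J \<in> borel_measurable M"
    using J by (simp add: is_stochastic_integral_def)
  ultimately show ?thesis
    using conv_in_prob_unique[OF prob_space_axioms SM _ _ SJ SL] by (simp add: L_def)
qed

section \<open>Law and consistency of the maximum likelihood estimator\<close>

text \<open>Substituting \<open>J k\<close> turns the estimator into \<open>\<theta>0\<close> plus a weighted sum of noises;
the Fisher information is the factor that normalises its variance.\<close>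

lemma mle_standardised:
  fixes J :: "nat \<Rightarrow> 'a \<Rightarrow> real"
  assumes N: "N \<ge> 1" and mu_pos: "\<And>k. k \<ge> 1 \<Longrightarrow> \<mu> k > 0" and q_pos: "\<And>k. k \<ge> 1 \<Longrightarrow> q k > 0"
    and sigma: "\<sigma> > 0" and T: "T > 0"
    and J: "\<And>k. 1 \<le> k \<Longrightarrow> k \<le> N \<Longrightarrow> J k \<omega> = - (\<theta>0 * \<mu> k) * T + \<sigma> * q k * W k"
  shows "sqrt (fisher_information \<sigma> T \<mu> q N) * (theta_hat T \<mu> q J N \<omega> - \<theta>0)
     = - (\<Sum>k=1..N. \<mu> k / q k * W k) / sqrt (T * (\<Sum>k=1..N. (\<mu> k / q k)\<^sup>2))"
proof -
  define S where "S = (\<Sum>k=1..N. (\<mu> k / q k)\<^sup>2)"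
  define V where "V = (\<Sum>k=1..N. \<mu> k / q k * W k)"
  have S_eq: "(\<Sum>k=1..N. (\<mu> k)\<^sup>2 / (q k)\<^sup>2) = S"
    by (simp add: S_def power_divide)
  have S: "S > 0"
    unfolding S_def using N by (intro sum_pos zero_less_power divide_pos_pos mu_pos q_pos) auto
  have "(\<Sum>k=1..N. \<mu> k / (q k)\<^sup>2 * J k \<omega>) = (\<Sum>k=1..N. - \<theta>0 * T * (\<mu> k / q k)\<^sup>2 + \<sigma> * (\<mu> k / q k * W k))"
  proof (intro sum.cong refl)
    fix k assume k: "k \<in> {1..N}"
    then have k': "1 \<le> k" "k \<le> N" by auto
    then have "q k \<noteq> 0" using q_pos[of k] by simp
    then show "\<mu> k / (q k)\<^sup>2 * J k \<omega> = - \<theta>0 * T * (\<mu> k / q k)\<^sup>2 + \<sigma> * (\<mu> k / q k * W k)"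
      unfolding J[OF k'] by (simp add: field_simps power2_eq_square)
  qed
  also have "\<dots> = - \<theta>0 * T * S + \<sigma> * V"
    by (simp only: sum.distrib sum_distrib_left[symmetric] S_def V_def)
  finally have num: "(\<Sum>k=1..N. \<mu> k / (q k)\<^sup>2 * J k \<omega>) = - \<theta>0 * T * S + \<sigma> * V" .
  have "theta_hat T \<mu> q J N \<omega> - \<theta>0 = - (\<sigma> * V) / (T * S)"
    unfolding theta_hat_def S_eq num using T S by (simp add: field_simps)
  moreover have "sqrt (fisher_information \<sigma> T \<mu> q N) = sqrt (T * S) / \<sigma>"
    unfolding fisher_information_def S_eq using sigma by (simp add: real_sqrt_divide)
  ultimately have "sqrt (fisher_information \<sigma> T \<mu> q N) * (theta_hat T \<mu> q J N \<omega> - \<theta>0)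
      = - (V * (sqrt (T * S) / (T * S)))"
    using sigma by (simp del: real_sqrt_mult)
  also have "sqrt (T * S) / (T * S) = 1 / sqrt (T * S)"
    using T S by (metis inverse_eq_divide mult_pos_pos sqrt_divide_self_eq less_imp_le)
  finally show ?thesis
    by (simp add: S_def V_def)
qed

lemma brownian_weighted_sum_standard_normal:
  assumes basis: "stochastic_basis M F" and bm: "\<And>k. k \<ge> 1 \<Longrightarrow> brownian_motion M F (w k)"
    and indep: "indep_processes M w {1..}" and T: "T > 0" and N: "N \<ge> 1"
    and b: "\<And>k. k \<ge> 1 \<Longrightarrow> b k > 0"
  shows "distributed M lborel
    (\<lambda>\<omega>. - (\<Sum>k=1..N. b k * (w k T \<omega> - w k 0 \<omega>)) / sqrt (T * (\<Sum>k=1..N. (b k)\<^sup>2))) std_normal_density"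
proof -
  interpret prob_space M using basis by (rule stochastic_basis_prob_space)
  define S where "S = (\<Sum>k=1..N. (b k)\<^sup>2)"
  have S: "S > 0"
    unfolding S_def using N by (intro sum_pos zero_less_power b) auto
  have "indep_vars (\<lambda>_. borel) (\<lambda>k \<omega>. b k * ((\<lambda>t\<in>{0..}. w k t \<omega>) T - (\<lambda>t\<in>{0..}. w k t \<omega>) 0)) {1..N}"
  proof (rule indep_vars_compose2[where Y="\<lambda>k x. b k * (x T - x 0)"])
    show "indep_vars (\<lambda>_. PiM {0..} (\<lambda>_. borel)) (\<lambda>k \<omega>. \<lambda>t\<in>{0..}. w k t \<omega>) {1..N}"
      using indep unfolding indep_processes_def by (rule indep_vars_subset) auto
    have "(\<lambda>x. x t) \<in> measurable (PiM {0..} (\<lambda>_. borel)) borel" if "0 \<le> t" for t :: real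
      using that by (intro measurable_component_singleton) auto
    then show "(\<lambda>x. b k * (x T - x 0)) \<in> borel_measurable (PiM {0..} (\<lambda>_. borel))" for k
      using T by (intro borel_measurable_times borel_measurable_diff borel_measurable_const) auto
  qed
  then have ind: "indep_vars (\<lambda>_. borel) (\<lambda>k \<omega>. b k * (w k T \<omega> - w k 0 \<omega>)) {1..N}"
    using T by simp
  have "distributed M lborel (\<lambda>\<omega>. \<Sum>k=1..N. b k * (w k T \<omega> - w k 0 \<omega>))
      (normal_density (\<Sum>k=1..N. 0) (sqrt (\<Sum>k=1..N. (b k * sqrt T)\<^sup>2)))"
  proof (rule sum_indep_normal[OF _ _ ind])
    fix k assume "k \<in> {1..N}"
    then have k: "k \<ge> 1" by simp
    have "distributed M lborel (\<lambda>\<omega>. 0 + b k * (w k T \<omega> - w k 0 \<omega>)) (normal_density (0 + b k * 0) (\<bar>b k\<bar> * sqrt T))"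
      using brownian_motion_increment[OF bm[OF k], of 0 T] T b[OF k] by (intro normal_density_affine) auto
    then show "distributed M lborel (\<lambda>\<omega>. b k * (w k T \<omega> - w k 0 \<omega>)) (normal_density 0 (b k * sqrt T))"
      using b[OF k] by simp
    show "0 < b k * sqrt T" using b[OF k] T by simp
  qed (use N in auto)
  moreover have "(\<Sum>k=1..N. (b k * sqrt T)\<^sup>2) = T * S"
    using T by (simp add: S_def power_mult_distrib sum_distrib_left mult.commute)
  ultimately have "distributed M lborel (\<lambda>\<omega>. \<Sum>k=1..N. b k * (w k T \<omega> - w k 0 \<omega>)) (normal_density 0 (sqrt (T * S)))"
    by simp
  then have "distributed M lborel (\<lambda>\<omega>. 0 + (- 1 / sqrt (T * S)) * (\<Sum>k=1..N. b k * (w k T \<omega> - w k 0 \<omega>)))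
      (normal_density (0 + (- 1 / sqrt (T * S)) * 0) (\<bar>- 1 / sqrt (T * S)\<bar> * sqrt (T * S)))"
    using T S by (intro normal_density_affine) auto
  moreover have "\<bar>- 1 / sqrt (T * S)\<bar> * sqrt (T * S) = 1"
    using T S by (simp add: abs_divide del: real_sqrt_mult)
  ultimately show ?thesis
    by (simp add: S_def)
qed

text \<open>The fourth moments are \<open>3 / (I n)\<^sup>2\<close>; if their sum is finite, then so is the sum of the fourth powers
almost surely, and its terms tend to zero.\<close>

lemma gaussian_errors_vanish_AE:
  assumes M: "prob_space M" and Z: "\<And>n. distributed M lborel (Z n) std_normal_density"
    and I: "\<And>n. I n > 0" and sum: "summable (\<lambda>n. 1 / (I n)\<^sup>2)"
  shows "AE \<omega> in M. (\<lambda>n. Z n \<omega> / sqrt (I n)) \<longlonglongrightarrow> 0"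
proof -
  interpret prob_space M by fact
  have [measurable]: "Z n \<in> borel_measurable M" for n
    using distributed_measurable[OF Z[of n]] by simp
  have moment: "(\<integral>\<^sup>+\<omega>. ennreal ((Z n \<omega> / sqrt (I n)) ^ 4) \<partial>M) = ennreal (3 / (I n)\<^sup>2)" for n
  proof -
    have "has_bochner_integral lborel (\<lambda>x. std_normal_density x * x ^ 4) 3"
      using std_normal_moment_even[of 2] by (simp add: fact_numeral)
    then have "has_bochner_integral M (\<lambda>\<omega>. (Z n \<omega>) ^ 4) 3"
      using distributed_integrable[OF Z[of n], of "\<lambda>x. x ^ 4"] distributed_integral[OF Z[of n], of "\<lambda>x. x ^ 4"]
      by (auto simp: has_bochner_integral_iff)
    then have "has_bochner_integral M (\<lambda>\<omega>. (Z n \<omega>) ^ 4 / (I n)\<^sup>2) (3 / (I n)\<^sup>2)"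
      by (intro has_bochner_integral_divide_zero) auto
    moreover have "(Z n \<omega> / sqrt (I n)) ^ 4 = (Z n \<omega>) ^ 4 / (I n)\<^sup>2" for \<omega>
    proof -
      have "(sqrt (I n)) ^ 4 = ((sqrt (I n))\<^sup>2)\<^sup>2" by (simp flip: power_mult)
      then show ?thesis using I[of n] by (simp add: power_divide)
    qed
    ultimately show ?thesis
      by (subst nn_integral_eq_integral) (auto simp: has_bochner_integral_iff)
  qed
  have "(\<integral>\<^sup>+\<omega>. (\<Sum>n. ennreal ((Z n \<omega> / sqrt (I n)) ^ 4)) \<partial>M) = (\<Sum>n. ennreal (3 / (I n)\<^sup>2))"
    by (simp add: nn_integral_suminf moment)
  also have "\<dots> \<noteq> \<infinity>"
    using summable_mult[OF sum, of 3] by (subst suminf_ennreal2) auto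
  finally have "AE \<omega> in M. (\<Sum>n. ennreal ((Z n \<omega> / sqrt (I n)) ^ 4)) \<noteq> \<infinity>"
    by (intro nn_integral_noteq_infinite) auto
  then show ?thesis
  proof eventually_elim
    case (elim \<omega>)
    then have "summable (\<lambda>n. (Z n \<omega> / sqrt (I n)) ^ 4)"
      by (intro summable_suminf_not_top) auto
    then have "(\<lambda>n. root 4 ((Z n \<omega> / sqrt (I n)) ^ 4)) \<longlonglongrightarrow> root 4 0"
      by (intro tendsto_real_root summable_LIMSEQ_zero)
    moreover have "root 4 (x ^ 4) = \<bar>x\<bar>" for x :: real
      using real_root_power_cancel[of 4 "\<bar>x\<bar>"] by simp
    ultimately have "(\<lambda>n. \<bar>Z n \<omega> / sqrt (I n)\<bar>) \<longlonglongrightarrow> 0"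
      by simp
    then show ?case
      by (rule tendsto_rabs_zero_cancel)
  qed
qed

text \<open>Well-posedness bounds \<open>(q k)\<^sup>2\<close> by a multiple of \<open>\<mu> k\<close>, so that \<open>(\<mu> k)\<^sup>2 / (q k)\<^sup>2\<close> is at least a
multiple of \<open>\<mu> k\<close>, and thus eventually at least one.\<close>

lemma fisher_information_growth:
  assumes mu_pos: "\<And>k. k \<ge> 1 \<Longrightarrow> \<mu> k > 0" and mu_lim: "filterlim \<mu> at_top sequentially"
    and q_pos: "\<And>k. k \<ge> 1 \<Longrightarrow> q k > 0" and sigma: "\<sigma> > 0" and T: "T > 0"
    and wellposed: "\<exists>\<theta>b>0. \<exists>N0\<ge>1. \<exists>c>0. \<forall>k\<ge>N0. 2 * \<theta>b - \<sigma>\<^sup>2 * (q k)\<^sup>2 / \<mu> k \<ge> c"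
  shows "\<exists>C>0. \<forall>\<^sub>F N in sequentially. C * real N \<le> fisher_information \<sigma> T \<mu> q N"
proof -
  obtain \<theta>b N0 c where wp: "\<theta>b > 0" "N0 \<ge> 1" "c > 0" "\<And>k. k \<ge> N0 \<Longrightarrow> 2 * \<theta>b - \<sigma>\<^sup>2 * (q k)\<^sup>2 / \<mu> k \<ge> c"
    using wellposed by blast
  have "\<forall>\<^sub>F k in sequentially. \<mu> k \<ge> 2 * \<theta>b / \<sigma>\<^sup>2"
    using mu_lim by (simp add: filterlim_at_top)
  then obtain K where K: "\<And>k. k \<ge> K \<Longrightarrow> \<mu> k \<ge> 2 * \<theta>b / \<sigma>\<^sup>2"
    by (auto simp: eventually_sequentially)
  define m where "m = max K N0"
  have ge1: "(\<mu> k)\<^sup>2 / (q k)\<^sup>2 \<ge> 1" if "k \<ge> m" for k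
  proof -
    have k: "k \<ge> 1" "k \<ge> K" "k \<ge> N0" using that wp(2) by (auto simp: m_def)
    have "\<sigma>\<^sup>2 * (q k)\<^sup>2 / \<mu> k \<le> 2 * \<theta>b"
      using wp(3) wp(4)[OF k(3)] by linarith
    then have "\<sigma>\<^sup>2 * (q k)\<^sup>2 \<le> 2 * \<theta>b * \<mu> k"
      using mu_pos[OF k(1)] by (simp add: pos_divide_le_eq)
    also have "\<dots> \<le> (\<sigma>\<^sup>2 * \<mu> k) * \<mu> k"
      using K[OF k(2)] mu_pos[OF k(1)] sigma by (intro mult_right_mono) (auto simp: pos_divide_le_eq mult.commute)
    finally have "(q k)\<^sup>2 \<le> (\<mu> k)\<^sup>2"
      using sigma by (simp add: power2_eq_square mult.assoc)
    then show ?thesis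
      using q_pos[OF k(1)] by (simp add: pos_le_divide_eq)
  qed
  have "T / \<sigma>\<^sup>2 / 2 * real N \<le> fisher_information \<sigma> T \<mu> q N" if N: "N \<ge> 2 * m" for N
  proof -
    have m1: "1 \<le> m" using wp(2) by (simp add: m_def)
    have "real N / 2 \<le> real (N - m)"
      using N by simp
    also have "\<dots> \<le> real (card {m..N})"
      by simp
    also have "\<dots> = (\<Sum>k=m..N. 1)"
      by simp
    also have "\<dots> \<le> (\<Sum>k=m..N. (\<mu> k)\<^sup>2 / (q k)\<^sup>2)"
      by (intro sum_mono ge1) auto
    also have "\<dots> \<le> (\<Sum>k=1..N. (\<mu> k)\<^sup>2 / (q k)\<^sup>2)"
      using m1 by (intro sum_mono2) auto
    finally have "T / \<sigma>\<^sup>2 * (real N / 2) \<le> T / \<sigma>\<^sup>2 * (\<Sum>k=1..N. (\<mu> k)\<^sup>2 / (q k)\<^sup>2)"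
      using T by (intro mult_left_mono) auto
    then show ?thesis by (simp add: fisher_information_def)
  qed
  then have "\<forall>\<^sub>F N in sequentially. T / \<sigma>\<^sup>2 / 2 * real N \<le> fisher_information \<sigma> T \<mu> q N"
    unfolding eventually_sequentially by blast
  moreover have "T / \<sigma>\<^sup>2 / 2 > 0" using T sigma by simp
  ultimately show ?thesis by blast
qed

section \<open>Convergence in distribution\<close>

text \<open>The characteristic functions of \<open>X n\<close> and \<open>Z n\<close> have the same limit by dominated convergence, as
\<open>exp (i t X) - exp (i t Z)\<close> is bounded by \<open>2\<close> and tends to zero almost surely.\<close>

lemma conv_in_distribution_slutsky:
  assumes M: "prob_space M" and X[measurable]: "\<And>n. X n \<in> borel_measurable M"
    and Z[measurable]: "\<And>n. Z n \<in> borel_measurable M"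
    and diff: "AE \<omega> in M. (\<lambda>n. X n \<omega> - Z n \<omega>) \<longlonglongrightarrow> 0"
    and dist: "\<forall>\<^sub>F n in sequentially. distr M borel (Z n) = std_normal_distribution"
  shows "conv_in_distribution M X std_normal_distribution"
proof -
  interpret prob_space M by fact
  have char_eq: "char (distr M borel (Y n)) t = (CLINT \<omega>|M. iexp (t * Y n \<omega>))"
    if "\<And>n. Y n \<in> borel_measurable M" for Y n t
    unfolding char_def using that by (subst integral_distr) auto
  have int: "integrable M (\<lambda>\<omega>. iexp (t * Y \<omega>))" if "Y \<in> borel_measurable M" for Y :: "'a \<Rightarrow> real" and t
  proof (rule integrable_iexp)
    show "(\<lambda>\<omega>. complex_of_real (t * Y \<omega>)) \<in> borel_measurable M"
      using that by measurable
  qed simp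
  have "weak_conv_m (\<lambda>n. distr M borel (X n)) std_normal_distribution"
  proof (rule levy_continuity)
    show "real_distribution (distr M borel (X n))" for n
      by (rule real_distribution_distr) measurable
    show "real_distribution std_normal_distribution"
      by (rule real_dist_normal_dist)
    fix t
    have lim: "(\<lambda>n. CLINT \<omega>|M. iexp (t * X n \<omega>) - iexp (t * Z n \<omega>)) \<longlonglongrightarrow> (CLINT \<omega>|M. 0)"
    proof (rule integral_dominated_convergence[where w="\<lambda>_. 2"])
      show "AE \<omega> in M. (\<lambda>n. iexp (t * X n \<omega>) - iexp (t * Z n \<omega>)) \<longlonglongrightarrow> 0"
        using diff
      proof eventually_elim
        case (elim \<omega>)
        have "(\<lambda>n. iexp (t * (X n \<omega> - Z n \<omega>)) - 1) \<longlonglongrightarrow> iexp (t * 0) - 1"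
          by (intro tendsto_intros elim)
        then have lim: "(\<lambda>n. norm (iexp (t * (X n \<omega> - Z n \<omega>)) - 1)) \<longlonglongrightarrow> 0"
          by (intro tendsto_norm_zero) simp
        have norm_eq: "norm (iexp (t * X n \<omega>) - iexp (t * Z n \<omega>)) = norm (iexp (t * (X n \<omega> - Z n \<omega>)) - 1)" for n
        proof -
          have "iexp (t * X n \<omega>) - iexp (t * Z n \<omega>) = iexp (t * Z n \<omega>) * (iexp (t * (X n \<omega> - Z n \<omega>)) - 1)"
          proof -
            have "iexp (t * Z n \<omega>) * iexp (t * (X n \<omega> - Z n \<omega>)) = iexp (t * X n \<omega>)"
              unfolding mult_exp_exp by (rule arg_cong[where f=exp]) (simp add: algebra_simps)
            then show ?thesis by (simp only: right_diff_distrib mult_1_right)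
          qed
          then show ?thesis by (simp only: norm_mult norm_exp_i_times mult_1_left)
        qed
        show ?case by (rule tendsto_norm_zero_cancel) (simp only: norm_eq lim)
      qed
      show "AE \<omega> in M. norm (iexp (t * X n \<omega>) - iexp (t * Z n \<omega>)) \<le> 2" for n
        by (intro AE_I2 order_trans[OF norm_triangle_ineq4]) (simp only: norm_exp_i_times)
    qed (simp_all add: borel_measurable_diff[OF borel_measurable_integrable[OF int[OF X]] borel_measurable_integrable[OF int[OF Z]]])
    have eq: "(CLINT \<omega>|M. iexp (t * X n \<omega>) - iexp (t * Z n \<omega>))
        = char (distr M borel (X n)) t - char (distr M borel (Z n)) t" for n
      unfolding char_eq[of X, OF X] char_eq[of Z, OF Z]
      by (rule Bochner_Integration.integral_diff[OF int[OF X] int[OF Z]])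
    have "(\<lambda>n. char (distr M borel (X n)) t - char (distr M borel (Z n)) t) \<longlonglongrightarrow> 0"
      using lim unfolding eq by (simp only: integral_zero)
    moreover have "\<forall>\<^sub>F n in sequentially. char (distr M borel (X n)) t - char (distr M borel (Z n)) t
        = char (distr M borel (X n)) t - char std_normal_distribution t"
      using dist by eventually_elim simp
    ultimately have "(\<lambda>n. char (distr M borel (X n)) t - char std_normal_distribution t) \<longlonglongrightarrow> 0"
      by (rule Lim_transform_eventually)
    then show "(\<lambda>n. char (distr M borel (X n)) t) \<longlonglongrightarrow> char std_normal_distribution t"
      by (simp add: LIM_zero_iff)
  qed
  then show ?thesis
    by (simp add: conv_in_distribution_def)
qed

section \<open>Asymptotics of the Bayesian estimator\<close>

theorem theorem4p14:
  fixes M :: "'a measure" and F :: "real \<Rightarrow> 'a measure"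
    and w :: "nat \<Rightarrow> real \<Rightarrow> 'a \<Rightarrow> real" and u0 :: "nat \<Rightarrow> 'a \<Rightarrow> real"
    and u :: "nat \<Rightarrow> real \<Rightarrow> 'a \<Rightarrow> real" and J :: "nat \<Rightarrow> 'a \<Rightarrow> real"
    and \<mu> q :: "nat \<Rightarrow> real" and \<sigma> T \<theta>0 :: real
    and I :: "nat \<Rightarrow> real" and th :: "nat \<Rightarrow> 'a \<Rightarrow> real"
    and \<rho> :: "real \<Rightarrow> real" and p :: "nat \<Rightarrow> 'a \<Rightarrow> real \<Rightarrow> real"
    and l l' f :: "real \<Rightarrow> real" and a :: "nat \<Rightarrow> real" and \<beta> :: "nat \<Rightarrow> 'a \<Rightarrow> real"
  assumes basis: "stochastic_basis M F"
    and bm: "\<And>k. k \<ge> 1 \<Longrightarrow> brownian_motion M F (w k)"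
    and indep: "indep_processes M w {1..}"
    and mu_pos: "\<And>k. k \<ge> 1 \<Longrightarrow> \<mu> k > 0"
    and mu_lim: "filterlim \<mu> at_top sequentially"
    and q_pos: "\<And>k. k \<ge> 1 \<Longrightarrow> q k > 0"
    and sigma_pos: "\<sigma> > 0" and T_pos: "T > 0"
    and u0_meas: "\<And>k. k \<ge> 1 \<Longrightarrow> u0 k \<in> borel_measurable (F 0)"
    and u0_nz: "\<And>k. k \<ge> 1 \<Longrightarrow> AE \<omega> in M. u0 k \<omega> \<noteq> 0"
    and wellposed: "\<exists>\<theta>b>0. \<exists>N0\<ge>1. \<exists>c>0. \<forall>k\<ge>N0. 2 * \<theta>b - \<sigma>\<^sup>2 * (q k)\<^sup>2 / \<mu> k \<ge> c"
    and theta0_pos: "\<theta>0 > 0"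
    and u_def: "u = fourier_mode \<sigma> \<mu> q u0 w \<theta>0"
    and J_integral: "\<And>k. k \<ge> 1 \<Longrightarrow> is_stochastic_integral M F T (\<lambda>t \<omega>. 1 / u k t \<omega>) (u k) (J k)"
    and I_def: "I = fisher_information \<sigma> T \<mu> q"
    and th_def: "th = theta_hat T \<mu> q J"
    and p_def: "p = (\<lambda>N \<omega>. post_density (I N) (th N \<omega>) \<rho>)"
    and prior: "\<rho> \<in> prior_class"
    and denominator: "\<And>N. N \<ge> 1 \<Longrightarrow> AE \<omega> in M.
          set_integrable lborel {0<..} (post_weight (I N) (th N \<omega>) \<rho>) \<and>
          (LINT \<eta>:{0<..}|lborel. post_weight (I N) (th N \<omega>) \<rho> \<eta>) > 0"
    and prior_nbhd: "\<exists>U. open U \<and> \<theta>0 \<in> U \<and> continuous_on U \<rho> \<and> (\<forall>\<theta>\<in>U. \<rho> \<theta> > 0)"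
    and loss: "l \<in> loss_class"
    and beta: "\<And>N. N \<ge> 1 \<Longrightarrow> AE \<omega> in M. strict_min_at (posterior_risk l (p N \<omega>)) {0<..} (\<beta> N \<omega>)"
    and a_pos: "\<And>N. N \<ge> 1 \<Longrightarrow> a N > 0"
    and f_meas: "f \<in> borel_measurable borel" and f_nonneg: "\<And>x. f x \<ge> 0"
    and C1: "\<exists>\<alpha>. 0 < \<alpha> \<and> \<alpha> < 1 \<and> (\<integral>\<^sup>+x. ennreal (f x * exp (- \<alpha> * x\<^sup>2 / 2)) \<partial>lborel) < \<infinity>"
    and C2: "\<And>\<delta>. \<delta> > 0 \<Longrightarrow> AE \<omega> in M.
          (\<lambda>N. \<integral>\<^sup>+x\<in>{x. \<bar>x\<bar> > sqrt (I N) * \<delta>}.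
                 ennreal (f x * \<rho> (th N \<omega> + x / sqrt (I N)) * exp (- x\<^sup>2 / 2)) \<partial>lborel)
            \<longlonglongrightarrow> 0"
    and loss': "l' \<in> loss_class"
    and i: "\<And>N x. N \<ge> 1 \<Longrightarrow> a N * l (x / sqrt (I N)) \<le> f x"
    and ii: "\<And>B. compact B \<Longrightarrow>
          (\<lambda>N. SUP x\<in>B. ennreal \<bar>a N * l (x / sqrt (I N)) - l' x\<bar>) \<longlonglongrightarrow> 0"
    and iii: "strict_min_at (\<lambda>r. \<integral>\<^sup>+x. ennreal (l' (x + r) * exp (- x\<^sup>2 / 2)) \<partial>lborel) UNIV 0"
  shows "(AE \<omega> in M. (\<lambda>N. sqrt (I N) * (\<beta> N \<omega> - th N \<omega>)) \<longlonglongrightarrow> 0)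
       \<and> (AE \<omega> in M. (\<lambda>N. ennreal (a N) * posterior_risk l (p N \<omega>) (\<beta> N \<omega>))
            \<longlonglongrightarrow> (\<integral>\<^sup>+x. ennreal (l' x * (exp (- x\<^sup>2 / 2) / sqrt (2 * pi))) \<partial>lborel))
       \<and> (AE \<omega> in M. (\<lambda>N. \<beta> N \<omega>) \<longlonglongrightarrow> \<theta>0)
       \<and> conv_in_distribution M (\<lambda>N \<omega>. sqrt (I N) * (\<beta> N \<omega> - \<theta>0)) std_normal_distribution"
proof -
  interpret prob_space M using basis by (rule stochastic_basis_prob_space)
  obtain C where C: "C > 0" "\<forall>\<^sub>F N in sequentially. C * real N \<le> I N"
    using fisher_information_growth[OF mu_pos mu_lim q_pos sigma_pos T_pos wellposed] unfolding I_def by blast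
  \<comment> \<open>The information vanishes at \<open>N = 0\<close>, so the limits are first taken along successors.\<close>
  have I_pos: "I (Suc n) > 0" for n
  proof -
    have "(\<Sum>k=1..Suc n. (\<mu> k)\<^sup>2 / (q k)\<^sup>2) > 0"
      by (intro sum_pos zero_less_power divide_pos_pos mu_pos q_pos) auto
    then show ?thesis
      using T_pos sigma_pos by (simp only: I_def fisher_information_def zero_less_mult_iff zero_less_divide_iff) auto
  qed
  have I_lim: "filterlim I at_top sequentially"
    by (rule filterlim_at_top_mono[OF filterlim_tendsto_pos_mult_at_top[OF tendsto_const C(1) filterlim_real_sequentially] C(2)])
  then have I_lim': "filterlim (\<lambda>n. I (Suc n)) at_top sequentially"
    by (rule filterlim_compose[OF _ filterlim_Suc])
  have I_sum: "summable (\<lambda>n. 1 / (I (Suc n))\<^sup>2)"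
  proof -
    have "summable (\<lambda>N. 1 / (I N)\<^sup>2)"
    proof (rule summable_comparison_test_ev)
      show "\<forall>\<^sub>F N in sequentially. norm (1 / (I N)\<^sup>2) \<le> (1 / C\<^sup>2) * inverse ((real N)\<^sup>2)"
        using C(2) eventually_gt_at_top[of 0]
      proof eventually_elim
        case (elim N)
        have "0 < C * real N" using C(1) elim by simp
        then have "1 / (I N)\<^sup>2 \<le> 1 / (C * real N)\<^sup>2"
          using elim by (intro divide_left_mono power_mono mult_pos_pos) auto
        then show ?case by (simp add: power_mult_distrib inverse_eq_divide)
      qed
      show "summable (\<lambda>N. (1 / C\<^sup>2) * inverse ((real N)\<^sup>2))"
        using inverse_power_summable[of 2] by (intro summable_mult) simp
    qed
    then show ?thesis by (subst summable_Suc_iff)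
  qed
  define Z where "Z N \<omega> = - (\<Sum>k=1..N. \<mu> k / q k * (w k T \<omega> - w k 0 \<omega>)) / sqrt (T * (\<Sum>k=1..N. (\<mu> k / q k)\<^sup>2))" for N \<omega>
  have "AE \<omega> in M. J k \<omega> = - (\<theta>0 * \<mu> k) * T + (\<sigma> * q k) * (w k T \<omega> - w k 0 \<omega>)" if k: "k \<ge> 1" for k
    using theta0_pos mu_pos[OF k] sigma_pos q_pos[OF k]
    by (intro stochastic_log_of_geometric_bm[OF basis bm[OF k] T_pos _ _ u0_meas[OF k] u0_nz[OF k] _ J_integral[OF k]])
       (auto simp: u_def fourier_mode_def power_mult_distrib)
  then have J_eq: "AE \<omega> in M. \<forall>k. k \<ge> 1 \<longrightarrow> J k \<omega> = - (\<theta>0 * \<mu> k) * T + (\<sigma> * q k) * (w k T \<omega> - w k 0 \<omega>)"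
    by (subst AE_all_countable) auto
  have th_eq: "AE \<omega> in M. \<forall>N\<ge>1. sqrt (I N) * (th N \<omega> - \<theta>0) = Z N \<omega>"
    using J_eq
  proof eventually_elim
    case (elim \<omega>)
    then show ?case
      unfolding I_def th_def Z_def by (intro allI impI mle_standardised mu_pos q_pos sigma_pos T_pos) auto
  qed
  have Z_dist: "distributed M lborel (Z N) std_normal_density" if "N \<ge> 1" for N
    unfolding Z_def
    by (rule brownian_weighted_sum_standard_normal[OF basis bm indep T_pos that]) (use mu_pos q_pos in auto)
  have J_meas[measurable]: "J k \<in> borel_measurable M" if "k \<ge> 1" for k
    using J_integral[OF that] by (simp add: is_stochastic_integral_def)
  have th_meas: "th N \<in> borel_measurable M" for N
    unfolding th_def theta_hat_def[abs_def]
    by (intro borel_measurable_divide borel_measurable_uminus borel_measurable_sum borel_measurable_times borel_measurable_const J_meas) auto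
  have Z_vanish: "AE \<omega> in M. (\<lambda>n. Z (Suc n) \<omega> / sqrt (I (Suc n))) \<longlonglongrightarrow> 0"
    by (rule gaussian_errors_vanish_AE[OF prob_space_axioms Z_dist I_pos I_sum]) simp
  have th_lim: "AE \<omega> in M. (\<lambda>n. th (Suc n) \<omega>) \<longlonglongrightarrow> \<theta>0"
    using Z_vanish th_eq
  proof eventually_elim
    case (elim \<omega>)
    have Z_eq: "Z (Suc n) \<omega> = sqrt (I (Suc n)) * (th (Suc n) \<omega> - \<theta>0)" for n
      using elim(2) by simp
    have "(\<lambda>n. sqrt (I (Suc n)) * (th (Suc n) \<omega> - \<theta>0) / sqrt (I (Suc n))) \<longlonglongrightarrow> 0"
      using elim(1) unfolding Z_eq .
    moreover have "sqrt (I (Suc n)) * (th (Suc n) \<omega> - \<theta>0) / sqrt (I (Suc n)) = th (Suc n) \<omega> - \<theta>0" for n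
      using I_pos[of n] by simp
    ultimately have "(\<lambda>n. th (Suc n) \<omega> - \<theta>0) \<longlonglongrightarrow> 0" by simp
    then show ?case by (simp add: LIM_zero_iff)
  qed
  \<comment> \<open>The radius \<open>\<delta>\<close> depends on the prior but not on the realisation, so that the tail condition is applied
at a single \<open>\<delta>\<close> and costs a single null set.\<close>
  obtain U where U: "open U" "\<theta>0 \<in> U" "continuous_on U \<rho>" "\<And>\<theta>. \<theta> \<in> U \<Longrightarrow> \<rho> \<theta> > 0"
    using prior_nbhd by blast
  obtain e where e: "e > 0" "cball \<theta>0 e \<subseteq> U"
    using U(1,2) open_contains_cball by blast
  define \<delta> where "\<delta> = e / 2"
  have delta: "\<delta> > 0" "cball \<theta>0 (2 * \<delta>) \<subseteq> U"
    using e by (auto simp: \<delta>_def)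
  have "bounded (\<rho> ` cball \<theta>0 (2 * \<delta>))"
    by (intro compact_imp_bounded compact_continuous_image continuous_on_subset[OF U(3) delta(2)] compact_cball)
  then obtain B where B: "\<And>x. x \<in> cball \<theta>0 (2 * \<delta>) \<Longrightarrow> \<rho> x \<le> B"
    unfolding bounded_iff by (metis abs_le_D1 imageI real_norm_def)
  have rho_cont: "isCont \<rho> \<theta>0"
    using U by (simp add: continuous_on_eq_continuous_at)
  have unif: "uniform_limit (cball 0 K) (\<lambda>N x. a N * l (x / sqrt (I N))) l' sequentially" for K
  proof (rule uniform_limitI)
    fix e :: real assume "e > 0"
    then have "\<forall>\<^sub>F N in sequentially. (SUP x\<in>cball 0 K. ennreal \<bar>a N * l (x / sqrt (I N)) - l' x\<bar>) < ennreal e"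
      using order_tendstoD(2)[OF ii[OF compact_cball[of 0 K]]] by simp
    then show "\<forall>\<^sub>F N in sequentially. \<forall>x\<in>cball 0 K. dist (a N * l (x / sqrt (I N))) (l' x) < e"
    proof eventually_elim
      case (elim N)
      show ?case
      proof
        fix x :: real assume "x \<in> cball 0 K"
        then have "ennreal \<bar>a N * l (x / sqrt (I N)) - l' x\<bar> < ennreal e"
          by (intro le_less_trans[OF SUP_upper elim])
        then show "dist (a N * l (x / sqrt (I N))) (l' x) < e"
          by (simp add: dist_real_def ennreal_less_iff)
      qed
    qed
  qed
  have f_int: "(\<integral>\<^sup>+x. ennreal (f x * exp (- x\<^sup>2 / 2)) \<partial>lborel) < \<infinity>"
  proof -
    obtain \<alpha> where \<alpha>: "0 < \<alpha>" "\<alpha> < 1" "(\<integral>\<^sup>+x. ennreal (f x * exp (- \<alpha> * x\<^sup>2 / 2)) \<partial>lborel) < \<infinity>"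
      using C1 by blast
    have "\<alpha> * x\<^sup>2 \<le> x\<^sup>2" for x :: real
      using \<alpha> by (intro mult_left_le_one_le) auto
    then have "(\<integral>\<^sup>+x. ennreal (f x * exp (- x\<^sup>2 / 2)) \<partial>lborel) \<le> (\<integral>\<^sup>+x. ennreal (f x * exp (- \<alpha> * x\<^sup>2 / 2)) \<partial>lborel)"
      using f_nonneg by (intro nn_integral_mono ennreal_leI mult_left_mono) auto
    then show ?thesis using \<alpha>(3) by (rule le_less_trans)
  qed
  have den: "AE \<omega> in M. \<forall>n. set_integrable lborel {0<..} (post_weight (I (Suc n)) (th (Suc n) \<omega>) \<rho>) \<and>
          (LINT \<eta>:{0<..}|lborel. post_weight (I (Suc n)) (th (Suc n) \<omega>) \<rho> \<eta>) > 0"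
    by (subst AE_all_countable) (intro allI denominator; simp)
  have bayes: "AE \<omega> in M. \<forall>n. strict_min_at (posterior_risk l (p (Suc n) \<omega>)) {0<..} (\<beta> (Suc n) \<omega>)"
    by (subst AE_all_countable) (intro allI beta; simp)
  have ae: "AE \<omega> in M. (\<lambda>N. sqrt (I N) * (\<beta> N \<omega> - th N \<omega>)) \<longlonglongrightarrow> 0
     \<and> (\<lambda>N. ennreal (a N) * posterior_risk l (p N \<omega>) (\<beta> N \<omega>))
            \<longlonglongrightarrow> (\<integral>\<^sup>+x. ennreal (l' x * (exp (- x\<^sup>2 / 2) / sqrt (2 * pi))) \<partial>lborel)"
    using th_lim den bayes C2[OF delta(1)]
  proof eventually_elim
    case (elim \<omega>)
    have loss_facts: "\<And>n. a (Suc n) > 0" "\<And>n x. a (Suc n) * l (x / sqrt (I (Suc n))) \<le> f x"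
      "\<And>K. uniform_limit (cball 0 K) (\<lambda>n x. a (Suc n) * l (x / sqrt (I (Suc n)))) l' sequentially"
    proof -
      show "a (Suc n) > 0" "a (Suc n) * l (x / sqrt (I (Suc n))) \<le> f x" for n x
        by (simp_all add: a_pos i)
      show "uniform_limit (cball 0 K) (\<lambda>n x. a (Suc n) * l (x / sqrt (I (Suc n)))) l' sequentially" for K
        by (rule filterlim_compose[OF unif filterlim_Suc])
    qed
    have limits: "(\<lambda>n. sqrt (I (Suc n)) * (\<beta> (Suc n) \<omega> - th (Suc n) \<omega>)) \<longlonglongrightarrow> 0"
      "(\<lambda>n. ennreal (a (Suc n)) * posterior_risk l (post_density (I (Suc n)) (th (Suc n) \<omega>) \<rho>) (\<beta> (Suc n) \<omega>))
            \<longlonglongrightarrow> (\<integral>\<^sup>+x. ennreal (l' x * (exp (- x\<^sup>2 / 2) / sqrt (2 * pi))) \<partial>lborel)"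
      using rescaled_bayes_limit[OF I_pos I_lim' elim(1) theta0_pos prior rho_cont U(4)[OF U(2)] delta(1) B _ _ loss loss'
        loss_facts(1) f_meas f_int loss_facts(2,3) LIMSEQ_Suc[OF elim(4)] iii, of "\<lambda>n. \<beta> (Suc n) \<omega>"] elim(2,3)
      by (auto simp: p_def)
    show ?case
      unfolding p_def by (rule conjI; rule LIMSEQ_imp_Suc; rule limits)
  qed
  have beta_lim: "AE \<omega> in M. (\<lambda>N. \<beta> N \<omega>) \<longlonglongrightarrow> \<theta>0"
    using ae th_lim
  proof eventually_elim
    case (elim \<omega>)
    have "(\<lambda>n. inverse (sqrt (I (Suc n)))) \<longlonglongrightarrow> 0"
      by (intro tendsto_inverse_0_at_top filterlim_compose[OF sqrt_at_top I_lim'])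
    then have "(\<lambda>n. inverse (sqrt (I (Suc n))) * (sqrt (I (Suc n)) * (\<beta> (Suc n) \<omega> - th (Suc n) \<omega>)) + th (Suc n) \<omega>) \<longlonglongrightarrow> 0 * 0 + \<theta>0"
      using LIMSEQ_Suc[OF conjunct1[OF elim(1)]] elim(2) by (intro tendsto_add tendsto_mult) auto
    moreover have "inverse (sqrt (I (Suc n))) * (sqrt (I (Suc n)) * (\<beta> (Suc n) \<omega> - th (Suc n) \<omega>)) + th (Suc n) \<omega> = \<beta> (Suc n) \<omega>" for n
      using I_pos[of n] by (simp add: mult.assoc[symmetric])
    ultimately show ?case by (simp add: LIMSEQ_imp_Suc[of _ \<theta>0])
  qed
  have beta_meas: "\<beta> N \<in> borel_measurable M" if "N \<ge> 1" for N
    by (rule borel_measurable_bayes_estimator[OF stochastic_basis_complete[OF basis] loss prior th_meas denominator[OF that]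
          beta[OF that, unfolded p_def]])
  have I0: "I 0 = 0"
    by (simp add: I_def fisher_information_def)
  have "conv_in_distribution M (\<lambda>N \<omega>. sqrt (I N) * (\<beta> N \<omega> - \<theta>0)) std_normal_distribution"
  proof (rule conv_in_distribution_slutsky[OF prob_space_axioms, where Z="\<lambda>N \<omega>. sqrt (I N) * (th N \<omega> - \<theta>0)"])
    show "(\<lambda>\<omega>. sqrt (I N) * (\<beta> N \<omega> - \<theta>0)) \<in> borel_measurable M" for N
      using beta_meas[of N] by (cases "N = 0") (auto simp: I0)
    show "(\<lambda>\<omega>. sqrt (I N) * (th N \<omega> - \<theta>0)) \<in> borel_measurable M" for N
      using th_meas by measurable
    show "AE \<omega> in M. (\<lambda>N. sqrt (I N) * (\<beta> N \<omega> - \<theta>0) - sqrt (I N) * (th N \<omega> - \<theta>0)) \<longlonglongrightarrow> 0"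
      using ae by eventually_elim (simp add: algebra_simps)
    show "\<forall>\<^sub>F N in sequentially. distr M borel (\<lambda>\<omega>. sqrt (I N) * (th N \<omega> - \<theta>0)) = std_normal_distribution"
      using eventually_ge_at_top[of 1]
    proof eventually_elim
      case (elim N)
      have "distr M borel (\<lambda>\<omega>. sqrt (I N) * (th N \<omega> - \<theta>0)) = distr M borel (Z N)"
        using th_eq elim th_meas distributed_measurable[OF Z_dist[OF elim]]
        by (intro distr_cong_AE) (auto elim!: eventually_mono)
      also have "\<dots> = distr M lborel (Z N)"
        by (rule distr_cong) auto
      also have "\<dots> = std_normal_distribution"
        using Z_dist[OF elim] by (simp add: distributed_def)
      finally show ?case .
    qed
  qed
  with ae beta_lim show ?thesis by auto
qed

end
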